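(* Let $f$ be an AC symbol over a finite set $C$ of constants, $\gg_f$ a total admissible ordering on $f$-monomials extending a total ordering $\gg_C$ on $C$ in which every nonconstant $f$-monomial is greater than every constant, $R_f$ a canonical AC rewrite system on $f$-monomials oriented by $\gg_f$, and $R_C$ a canonical rewrite system of constant rules oriented by $\gg_C$. Let $S_f=\{l=r\mid l\rightarrow r\in R_f\}$ and $S_C=\{c=d\mid c\rightarrow d\in R_C\}$. Then the rewrite system $R'_f$ computed by ${\bf update}_{AC}(R_f,R_C,\gg_f)$ is a canonical rewrite system for $ACCC(S_f\cup S_C)$ with respect to $\gg_f$: it is terminating and confluent and, for all $f$-monomials $s,t$, $s=t\in ACCC(S_f\cup S_C)$ iff $s,t$ have the same normal form with respect to $R'_f$.
   Context: $f$-monomials: $f(M)$, $M$ a nonempty finite multiset over $C$; a constant $c$ is identified with $f(\{\!\{c\}\!\})$. On multisets $\cup$ is multiset sum, $\cap$ multiset intersection, $-$ truncated difference, $\subseteq$ sub-multiset. A rule $f(A)\rightarrow f(B)$ rewrites $f(M)$ to $f((M-A)\cup B)$ when $A\subseteq M$. Admissible: total well-founded ordering with $f(A)\gg_f f(B)$ when $B$ is a proper sub-multiset of $A$ and $f(A_1)\gg_f f(A_2)\Rightarrow f(A_1\cup B)\gg_f f(A_2\cup B)$. $ACCC(E)$: smallest equivalence relation on $f$-monomials containing $E$ such that $f(M_1)=f(M_2)$, $f(N_1)=f(N_2)$ in it imply $f(M_1\cup N_1)=f(M_2\cup N_2)$ in it. Critical pair of distinct rules $f(A_1)\rightarrow f(A_2)$,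 $f(B_1)\rightarrow f(B_2)$: $(f((AB-A_1)\cup A_2),f((AB-B_1)\cup B_2))$ with $AB=(A_1\cup B_1)-(A_1\cap B_1)$. $NF(t,R)$ denotes a normal form of $t$ w.r.t. $R$. Procedure ${\bf update}_{AC}(R_f,R_C,\gg_f)$: Let $S:=\{l=r\mid l\rightarrow r\in R_f,\ NF(l,R_C)\ne l\}$; remove these rules from $R_f$; $R'_f:=R_C\cup R_f$; $NR_C:=\emptyset$. While $S\ne\emptyset$: set $T:=\emptyset$; for each $l=r\in S$: remove it from $S$; if $NF(l,R'_f)\ne NF(r,R'_f)$, orient the pair of these normal forms by $\gg_f$ as $l'\rightarrow r'$; for each rule $l''\rightarrow r''\in R'_f$ compute their critical pair $(s_1,s_2)$ and, if $NF(s_1,R'_f)\ne NF(s_2,R'_f)$, add $NF(s_1,R'_f)=NF(s_2,R'_f)$ to $T$; add $l'\rightarrow r'$ to $R'_f$; interreduce the other rules of $R'_f$ by $l'\rightarrow r'$ (rules whose left side becomes reducible are removed and their equations put into $T$; rules where only the right side is reducible get a normalized right side); if $l'\rightarrow r'$ is a new constant rule, add it to $NR_C$. After the loop over $S$, set $S:=T$. Return $(R'_f,NR_C)$. *)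

theory Defs
  imports "HOL-Library.Multiset" "HOL-Library.Confluence"
begin

text \<open>
  The monomial \<open>f(M)\<close> is represented by the multiset \<open>M\<close> of its arguments, so that the constant
  \<open>c\<close> is \<open>{#c#}\<close>. Rules \<open>l \<rightarrow> r\<close> and equations \<open>l = r\<close> are both pairs \<open>(l, r)\<close>.
\<close>

type_synonym 'c rules = "('c multiset \<times> 'c multiset) set"

definition monomials :: "'c set \<Rightarrow> 'c multiset set" where
  "monomials C = {M. M \<noteq> {#} \<and> set_mset M \<subseteq> C}"

definition strict_total_order_on :: "'a set \<Rightarrow> ('a \<Rightarrow> 'a \<Rightarrow> bool) \<Rightarrow> bool" where
  "strict_total_order_on A gt \<longleftrightarrow> irreflp_on A gt \<and> transp_on A gt \<and> totalp_on A gt"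

definition admissible :: "'c set \<Rightarrow> ('c multiset \<Rightarrow> 'c multiset \<Rightarrow> bool) \<Rightarrow> bool" where
  "admissible C gt \<longleftrightarrow>
     strict_total_order_on (monomials C) gt \<and>
     wfp_on (monomials C) gt\<inverse>\<inverse> \<and>
     (\<forall>A\<in>monomials C. \<forall>B\<in>monomials C. B \<subset># A \<longrightarrow> gt A B) \<and>
     (\<forall>A\<^sub>1\<in>monomials C. \<forall>A\<^sub>2\<in>monomials C. \<forall>B. set_mset B \<subseteq> C \<longrightarrow>
        gt A\<^sub>1 A\<^sub>2 \<longrightarrow> gt (A\<^sub>1 + B) (A\<^sub>2 + B))"

definition oriented :: "'c set \<Rightarrow> ('c multiset \<Rightarrow> 'c multiset \<Rightarrow> bool) \<Rightarrow> 'c rules \<Rightarrow> bool" where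
  "oriented C gt R \<longleftrightarrow> (\<forall>(l, r)\<in>R. l \<in> monomials C \<and> r \<in> monomials C \<and> gt l r)"

definition rstep :: "'c set \<Rightarrow> 'c rules \<Rightarrow> 'c multiset \<Rightarrow> 'c multiset \<Rightarrow> bool" where
  "rstep C R M N \<longleftrightarrow> M \<in> monomials C \<and> (\<exists>(A, B)\<in>R. A \<subseteq># M \<and> N = (M - A) + B)"

definition reducible :: "'c set \<Rightarrow> 'c rules \<Rightarrow> 'c multiset \<Rightarrow> bool" where
  "reducible C R M \<longleftrightarrow> (\<exists>N. rstep C R M N)"

text \<open>
  \<open>NF C R t u\<close>: \<open>u\<close> is a normal form of \<open>t\<close>. This is a relation, since the systems occurring
  while the procedure runs need not be confluent.
\<close>

definition NF :: "'c set \<Rightarrow> 'c rules \<Rightarrow> 'c multiset \<Rightarrow> 'c multiset \<Rightarrow> bool" where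
  "NF C R t u \<longleftrightarrow> (rstep C R)\<^sup>*\<^sup>* t u \<and> \<not> reducible C R u"

definition canonical :: "('a \<Rightarrow> 'a \<Rightarrow> bool) \<Rightarrow> bool" where
  "canonical step \<longleftrightarrow> wfP step\<inverse>\<inverse> \<and> confluentp step"

inductive_set ACCC :: "'c set \<Rightarrow> 'c rules \<Rightarrow> 'c rules" for C :: "'c set" and E :: "'c rules" where
  base: "(s, t) \<in> E \<Longrightarrow> (s, t) \<in> ACCC C E"
| refl: "s \<in> monomials C \<Longrightarrow> (s, s) \<in> ACCC C E"
| sym: "(s, t) \<in> ACCC C E \<Longrightarrow> (t, s) \<in> ACCC C E"
| trans: "(s, t) \<in> ACCC C E \<Longrightarrow> (t, u) \<in> ACCC C E \<Longrightarrow> (s, u) \<in> ACCC C E"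
| union: "(M\<^sub>1, M\<^sub>2) \<in> ACCC C E \<Longrightarrow> (N\<^sub>1, N\<^sub>2) \<in> ACCC C E \<Longrightarrow>
    (M\<^sub>1 + N\<^sub>1, M\<^sub>2 + N\<^sub>2) \<in> ACCC C E"

definition canonical_for ::
  "'c set \<Rightarrow> ('c multiset \<Rightarrow> 'c multiset \<Rightarrow> bool) \<Rightarrow> 'c rules \<Rightarrow> 'c rules \<Rightarrow> bool" where
  "canonical_for C gt K R \<longleftrightarrow>
     oriented C gt R \<and> canonical (rstep C R) \<and>
     (\<forall>s\<in>monomials C. \<forall>t\<in>monomials C. (s, t) \<in> K \<longleftrightarrow> (\<exists>u. NF C R s u \<and> NF C R t u))"

fun critical_pair ::
  "'c multiset \<times> 'c multiset \<Rightarrow> 'c multiset \<times> 'c multiset \<Rightarrow> 'c multiset \<times> 'c multiset" where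
  "critical_pair (A\<^sub>1, A\<^sub>2) (B\<^sub>1, B\<^sub>2) =
     (let AB = (A\<^sub>1 + B\<^sub>1) - (A\<^sub>1 \<inter># B\<^sub>1) in ((AB - A\<^sub>1) + A\<^sub>2, (AB - B\<^sub>1) + B\<^sub>2))"

definition const_rules :: "('c \<times> 'c) set \<Rightarrow> 'c rules" where
  "const_rules R\<^sub>C = {({#c#}, {#d#}) | c d. (c, d) \<in> R\<^sub>C}"

text \<open>
  A state \<open>(S, T, R, N)\<close> of the procedure holds the values of \<open>S\<close>, \<open>T\<close>, \<open>R'\<^sub>f\<close> and \<open>NR\<^sub>C\<close>. Each
  \<open>discard\<close> or \<open>orient\<close> step is one iteration of the inner loop; \<open>next_round\<close> is the assignment
  \<open>S := T\<close> followed by \<open>T := \<emptyset>\<close> at the start of the next outer iteration. The order in which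
  equations are taken from \<open>S\<close> and the normal forms used are arbitrary.

  In \<open>orient\<close>, \<open>n\<^sub>1 \<rho>\<close> and \<open>n\<^sub>2 \<rho>\<close> are the chosen normal forms of the critical pair of the new rule
  with the rule \<open>\<rho>\<close>, and \<open>n\<^sub>3 \<rho>\<close> is the right side of \<open>\<rho>\<close> after interreduction. The rules may be
  interreduced in any order: a normal form computed from a system in which some rules are already
  removed or have new right sides is also a normal form with respect to \<open>insert (l', r') R\<close>.
\<close>

inductive update_step ::
  "'c set \<Rightarrow> ('c multiset \<Rightarrow> 'c multiset \<Rightarrow> bool) \<Rightarrow>
   'c rules \<times> 'c rules \<times> 'c rules \<times> ('c \<times> 'c) set \<Rightarrow>
   'c rules \<times> 'c rules \<times> 'c rules \<times> ('c \<times> 'c) set \<Rightarrow> bool"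
  for C :: "'c set" and gt :: "'c multiset \<Rightarrow> 'c multiset \<Rightarrow> bool" where
  discard:
  "\<lbrakk> (l, r) \<in> S; NF C R l u; NF C R r u \<rbrakk> \<Longrightarrow>
   update_step C gt (S, T, R, N) (S - {(l, r)}, T, R, N)"
| orient:
  "\<lbrakk> (l, r) \<in> S; NF C R l u; NF C R r v; u \<noteq> v;
     (l', r') = (u, v) \<or> (l', r') = (v, u); gt l' r';
     \<forall>\<rho>\<in>R. NF C R (fst (critical_pair (l', r') \<rho>)) (n\<^sub>1 \<rho>) \<and>
           NF C R (snd (critical_pair (l', r') \<rho>)) (n\<^sub>2 \<rho>);
     CP = {(n\<^sub>1 \<rho>, n\<^sub>2 \<rho>) | \<rho>. \<rho> \<in> R \<and> n\<^sub>1 \<rho> \<noteq> n\<^sub>2 \<rho>};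
     removed = {\<rho> \<in> R. reducible C {(l', r')} (fst \<rho>)};
     \<forall>\<rho>\<in>R - removed.
       if reducible C {(l', r')} (snd \<rho>)
       then NF C (insert (l', r') R) (snd \<rho>) (n\<^sub>3 \<rho>)
       else n\<^sub>3 \<rho> = snd \<rho> \<rbrakk> \<Longrightarrow>
   update_step C gt (S, T, R, N)
     (S - {(l, r)}, T \<union> CP \<union> removed,
      insert (l', r') {(fst \<rho>, n\<^sub>3 \<rho>) | \<rho>. \<rho> \<in> R - removed},
      N \<union> {(c, d). (l', r') = ({#c#}, {#d#})})"
| next_round:
  "T \<noteq> {} \<Longrightarrow> update_step C gt ({}, T, R, N) (T, {}, R, N)"

definition update_init ::
  "'c set \<Rightarrow> 'c rules \<Rightarrow> ('c \<times> 'c) set \<Rightarrow>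
   'c rules \<times> 'c rules \<times> 'c rules \<times> ('c \<times> 'c) set" where
  "update_init C R\<^sub>f R\<^sub>C =
     (let S = {(l, r) \<in> R\<^sub>f. \<exists>l'. NF C (const_rules R\<^sub>C) l l' \<and> l' \<noteq> l}
      in (S, {}, const_rules R\<^sub>C \<union> (R\<^sub>f - S), {}))"

text \<open>\<open>update_AC C gt R\<^sub>f R\<^sub>C R' N\<close>: some run of the procedure returns \<open>(R', N)\<close>.\<close>

definition update_AC ::
  "'c set \<Rightarrow> ('c multiset \<Rightarrow> 'c multiset \<Rightarrow> bool) \<Rightarrow> 'c rules \<Rightarrow> ('c \<times> 'c) set \<Rightarrow>
   'c rules \<Rightarrow> ('c \<times> 'c) set \<Rightarrow> bool" where
  "update_AC C gt R\<^sub>f R\<^sub>C R' N \<longleftrightarrow>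
     (update_step C gt)\<^sup>*\<^sup>* (update_init C R\<^sub>f R\<^sub>C) ({}, {}, R', N)"

definition update_AC_terminates ::
  "'c set \<Rightarrow> ('c multiset \<Rightarrow> 'c multiset \<Rightarrow> bool) \<Rightarrow> 'c rules \<Rightarrow> ('c \<times> 'c) set \<Rightarrow> bool" where
  "update_AC_terminates C gt R\<^sub>f R\<^sub>C \<longleftrightarrow>
     \<not> (\<exists>\<sigma>. \<sigma> 0 = update_init C R\<^sub>f R\<^sub>C \<and> (\<forall>i::nat. update_step C gt (\<sigma> i) (\<sigma> (Suc i))))"

end

theory Submission
  imports Defs Complex_Main
begin

text \<open>
  Correctness: call a peak \<open>a \<leftarrow> M \<rightarrow> b\<close> connected if \<open>a\<close> and \<open>b\<close> are linked by a chain of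
  equations all of whose members are smaller than \<open>M\<close>. Every step of the procedure keeps the
  peaks of \<open>R'\<^sub>f\<close> connected by the equations \<open>R'\<^sub>f \<union> S \<union> T\<close> and leaves their equational theory
  unchanged: an equation that disappears is always replaced by rewriting its two sides, and
  rewriting only moves downwards. Once \<open>S\<close> and \<open>T\<close> are empty, the peaks are connected by \<open>R'\<^sub>f\<close>
  itself, which gives confluence by well-founded induction. Initially, a rule of \<open>R\<^sub>f\<close> that is not
  moved to \<open>S\<close> has a left side disjoint from those of \<open>R\<^sub>C\<close>, so no critical pairs between the two
  systems matter.

  Termination: the left side of each new rule is irreducible for the current system, and the set of
  reducible monomials never shrinks, so by Dickson's lemma only finitely many rules are created;
  between two such events \<open>|S| + 2 |T|\<close> decreases.
\<close>

section \<open>Rewriting with oriented rules\<close>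

lemma monomials_add:
  "M \<in> monomials C \<Longrightarrow> set_mset X \<subseteq> C \<Longrightarrow> M + X \<in> monomials C"
  by (auto simp: monomials_def)

lemma monomials_diff_add:
  "M \<in> monomials C \<Longrightarrow> B \<in> monomials C \<Longrightarrow> (M - A) + B \<in> monomials C"
  by (auto simp: monomials_def dest: in_diffD)

lemma orientedD:
  assumes "oriented C gt R" and "(l, r) \<in> R"
  shows "l \<in> monomials C" and "r \<in> monomials C" and "gt l r"
  using assms by (auto simp: oriented_def)

lemma rstep_add:
  assumes "rstep C R M N" and "set_mset X \<subseteq> C"
  shows "rstep C R (M + X) (N + X)"
proof -
  obtain A B where AB: "(A, B) \<in> R" "A \<subseteq># M" "N = (M - A) + B" and M: "M \<in> monomials C"
    using assms(1) by (auto simp: rstep_def)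
  then obtain K where "M = A + K" by (auto simp: mset_subset_eq_exists_conv)
  then have "A \<subseteq># M + X" "N + X = (M + X - A) + B" using AB(3) by (simp_all add: ac_simps)
  then show ?thesis
    unfolding rstep_def using AB(1) monomials_add[OF M assms(2)] by blast
qed

lemma rsteps_add:
  "(rstep C R)\<^sup>*\<^sup>* M N \<Longrightarrow> set_mset X \<subseteq> C \<Longrightarrow> (rstep C R)\<^sup>*\<^sup>* (M + X) (N + X)"
  by (induction rule: rtranclp_induct) (auto intro: rtranclp.rtrancl_into_rtrancl rstep_add)

lemma rstep_mono: "rstep C R M N \<Longrightarrow> R \<subseteq> R' \<Longrightarrow> rstep C R' M N"
  by (auto simp: rstep_def)

lemma rsteps_mono: "(rstep C R)\<^sup>*\<^sup>* M N \<Longrightarrow> R \<subseteq> R' \<Longrightarrow> (rstep C R')\<^sup>*\<^sup>* M N"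
  by (induction rule: rtranclp_induct) (auto intro: rtranclp.rtrancl_into_rtrancl rstep_mono)

lemma rstep_rule: "(l, r) \<in> R \<Longrightarrow> l \<in> monomials C \<Longrightarrow> rstep C R l r"
  by (force simp: rstep_def)

lemma rstep_rule_add:
  "(l, r) \<in> R \<Longrightarrow> l + X \<in> monomials C \<Longrightarrow> rstep C R (l + X) (r + X)"
  unfolding rstep_def by (auto simp: add.commute intro!: bexI[of _ "(l, r)"])

lemma reducible_iff:
  "reducible C R M \<longleftrightarrow> M \<in> monomials C \<and> (\<exists>(l, r)\<in>R. l \<subseteq># M)"
  by (auto simp: reducible_def rstep_def)

text \<open>The multiset \<open>(A\<^sub>1 + B\<^sub>1) - (A\<^sub>1 \<inter># B\<^sub>1)\<close> is
  the countwise maximum, that is the least common multiple, of the left sides. Any \<open>M\<close>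
  containing both left sides contains it, and the rest of \<open>M\<close> is the context
  \<open>X\<close> shared by both reducts.\<close>

lemma critical_pair_add:
  assumes "A\<^sub>1 \<subseteq># M" and "B\<^sub>1 \<subseteq># M"
  obtains X where "X \<subseteq># M"
    and "(M - A\<^sub>1) + A\<^sub>2 = fst (critical_pair (A\<^sub>1, A\<^sub>2) (B\<^sub>1, B\<^sub>2)) + X"
    and "(M - B\<^sub>1) + B\<^sub>2 = snd (critical_pair (A\<^sub>1, A\<^sub>2) (B\<^sub>1, B\<^sub>2)) + X"
proof -
  define AB where "AB = (A\<^sub>1 + B\<^sub>1) - (A\<^sub>1 \<inter># B\<^sub>1)"
  have le: "count A\<^sub>1 x \<le> count M x" "count B\<^sub>1 x \<le> count M x" for x
    using assms by (auto simp: subseteq_mset_def)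
  show ?thesis
  proof
    show "M - AB \<subseteq># M" by simp
    show "(M - A\<^sub>1) + A\<^sub>2 = fst (critical_pair (A\<^sub>1, A\<^sub>2) (B\<^sub>1, B\<^sub>2)) + (M - AB)"
    proof (rule multiset_eqI)
      fix x show "count ((M - A\<^sub>1) + A\<^sub>2) x =
        count (fst (critical_pair (A\<^sub>1, A\<^sub>2) (B\<^sub>1, B\<^sub>2)) + (M - AB)) x"
        using le[of x] by (simp add: AB_def Let_def)
    qed
    show "(M - B\<^sub>1) + B\<^sub>2 = snd (critical_pair (A\<^sub>1, A\<^sub>2) (B\<^sub>1, B\<^sub>2)) + (M - AB)"
    proof (rule multiset_eqI)
      fix x show "count ((M - B\<^sub>1) + B\<^sub>2) x =
        count (snd (critical_pair (A\<^sub>1, A\<^sub>2) (B\<^sub>1, B\<^sub>2)) + (M - AB)) x"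
        using le[of x] by (simp add: AB_def Let_def)
    qed
  qed
qed

text \<open>The peak sits at the least common multiple itself. This makes critical pairs
  consequences of the rules and, for oriented rules, pairs of monomials.\<close>

lemma critical_pair_rsteps:
  assumes "(A\<^sub>1, A\<^sub>2) \<in> R" and "(B\<^sub>1, B\<^sub>2) \<in> R" and "A\<^sub>1 \<in> monomials C" and "B\<^sub>1 \<in> monomials C"
  obtains M where "rstep C R M (fst (critical_pair (A\<^sub>1, A\<^sub>2) (B\<^sub>1, B\<^sub>2)))"
    and "rstep C R M (snd (critical_pair (A\<^sub>1, A\<^sub>2) (B\<^sub>1, B\<^sub>2)))"
proof
  let ?M = "(A\<^sub>1 + B\<^sub>1) - (A\<^sub>1 \<inter># B\<^sub>1)"
  have sub: "A\<^sub>1 \<subseteq># ?M" "B\<^sub>1 \<subseteq># ?M"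
    by (auto simp: subseteq_mset_def)
  have "?M \<in> monomials C"
    using sub(1) assms(3,4) by (auto simp: monomials_def dest!: in_diffD)
  then have "rstep C R ?M ((?M - A\<^sub>1) + A\<^sub>2)" "rstep C R ?M ((?M - B\<^sub>1) + B\<^sub>2)"
    unfolding rstep_def using sub assms(1,2) by blast+
  then show "rstep C R ?M (fst (critical_pair (A\<^sub>1, A\<^sub>2) (B\<^sub>1, B\<^sub>2)))"
    and "rstep C R ?M (snd (critical_pair (A\<^sub>1, A\<^sub>2) (B\<^sub>1, B\<^sub>2)))"
    by (simp_all only: critical_pair.simps Let_def fst_conv snd_conv)
qed

section \<open>Equational chains inside a set of monomials\<close>

text \<open>\<open>D\<close> confines both ends of a step: a nontrivial chain inside
  \<open>below M\<close> has all its members smaller than \<open>M\<close>, while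
  \<open>D = monomials C\<close> gives the full theory. The context \<open>X\<close> may be empty
  although \<open>{#}\<close> is no monomial.\<close>

definition estep :: "'c rules \<Rightarrow> 'c multiset set \<Rightarrow> 'c multiset \<Rightarrow> 'c multiset \<Rightarrow> bool" where
  "estep E D s t \<longleftrightarrow> s \<in> D \<and> t \<in> D \<and>
     (\<exists>l r X. ((l, r) \<in> E \<or> (r, l) \<in> E) \<and> s = l + X \<and> t = r + X)"

definition conv :: "'c rules \<Rightarrow> 'c multiset set \<Rightarrow> 'c multiset \<Rightarrow> 'c multiset \<Rightarrow> bool" where
  "conv E D = (estep E D)\<^sup>*\<^sup>*"

lemma estep_sym: "estep E D s t \<Longrightarrow> estep E D t s"
  by (auto simp: estep_def)

lemma conv_refl [simp]: "conv E D s s"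
  by (simp add: conv_def)

lemma conv_trans: "conv E D s t \<Longrightarrow> conv E D t u \<Longrightarrow> conv E D s u"
  by (simp add: conv_def)

lemma conv_sym: "conv E D s t \<Longrightarrow> conv E D t s"
  unfolding conv_def
  by (induction rule: rtranclp_induct) (auto intro: converse_rtranclp_into_rtranclp estep_sym)

lemma conv_eq: "(l, r) \<in> E \<Longrightarrow> l + X \<in> D \<Longrightarrow> r + X \<in> D \<Longrightarrow> conv E D (l + X) (r + X)"
  unfolding conv_def by (rule r_into_rtranclp) (auto simp: estep_def)

text \<open>Main tool for changing the equations: only instances of single equations, in the given
  direction, have to be derived; symmetry does the rest.\<close>

lemma conv_replace:
  assumes "\<And>l r X. (l, r) \<in> E \<Longrightarrow> l + X \<in> D \<Longrightarrow> r + X \<in> D \<Longrightarrow> conv E' D' (l + X) (r + X)"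
    and "conv E D s t"
  shows "conv E' D' s t"
  using assms(2) unfolding conv_def[of E]
proof (induction rule: rtranclp_induct)
  case (step y z)
  then obtain l r X where "(l, r) \<in> E \<or> (r, l) \<in> E" "y = l + X" "z = r + X" "y \<in> D" "z \<in> D"
    by (auto simp: estep_def)
  then have "conv E' D' y z" using assms(1) conv_sym by metis
  then show ?case using step.IH conv_trans by blast
qed simp

lemma conv_mono: "conv E D s t \<Longrightarrow> E \<subseteq> E' \<Longrightarrow> D \<subseteq> D' \<Longrightarrow> conv E' D' s t"
  by (rule conv_replace[of E D]) (auto intro: conv_eq)

text \<open>Stated for \<open>monomials C\<close> because sets such as \<open>below M\<close> need
  not be closed under adding a context.\<close>

lemma conv_add:
  assumes "conv E (monomials C) s t" and X: "set_mset X \<subseteq> C"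
  shows "conv E (monomials C) (s + X) (t + X)"
  using assms(1) unfolding conv_def
proof (induction rule: rtranclp_induct)
  case (step y z)
  then obtain l r Y where "(l, r) \<in> E \<or> (r, l) \<in> E" "y = l + Y" "z = r + Y"
    and "y \<in> monomials C" "z \<in> monomials C"
    by (auto simp: estep_def)
  then have "estep E (monomials C) (y + X) (z + X)"
    unfolding estep_def using monomials_add[OF _ X] by (metis add.assoc)
  then show ?case using step.IH by simp
qed simp

lemma conv_imp_ACCC:
  assumes "conv E (monomials C) s t" and "E \<subseteq> monomials C \<times> monomials C" and "s \<in> monomials C"
  shows "(s, t) \<in> ACCC C E"
  using assms(1) unfolding conv_def
proof (induction rule: rtranclp_induct)
  case base
  show ?case using assms(3) by (rule ACCC.refl)
next
  case (step y z)
  then obtain l r X where lr: "(l, r) \<in> E \<or> (r, l) \<in> E" "y = l + X" "z = r + X"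
    and y: "y \<in> monomials C"
    by (auto simp: estep_def)
  have l: "(l, r) \<in> ACCC C E"
    using lr(1) by (auto intro: ACCC.base ACCC.sym)
  have "(y, z) \<in> ACCC C E"
  \<comment> \<open>The empty context is no monomial, so \<open>ACCC.refl\<close> does not cover it
    and \<open>ACCC.union\<close> can only be used for a nonempty one.\<close>
  proof (cases "X = {#}")
    case False
    then have "X \<in> monomials C" using y lr(2) by (auto simp: monomials_def)
    then show ?thesis using l lr(2,3) by (auto intro: ACCC.union ACCC.refl)
  qed (use l lr in simp)
  then show ?case using step.IH ACCC.trans by blast
qed

lemma ACCC_imp_conv:
  assumes "(s, t) \<in> ACCC C E" and E: "E \<subseteq> monomials C \<times> monomials C"
  shows "s \<in> monomials C \<and> t \<in> monomials C \<and> conv E (monomials C) s t"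
  using assms(1)
proof (induction rule: ACCC.induct)
  case (base s t)
  then show ?case using E conv_eq[of s t E "{#}" "monomials C"] by auto
next
  case (union M\<^sub>1 M\<^sub>2 N\<^sub>1 N\<^sub>2)
  then have sets: "set_mset N\<^sub>1 \<subseteq> C" "set_mset M\<^sub>2 \<subseteq> C" "set_mset N\<^sub>2 \<subseteq> C"
    by (auto simp: monomials_def)
  \<comment> \<open>One summand is changed at a time; the other serves as context.\<close>
  have "conv E (monomials C) (M\<^sub>1 + N\<^sub>1) (M\<^sub>2 + N\<^sub>1)"
    using union sets conv_add by blast
  moreover have "conv E (monomials C) (M\<^sub>2 + N\<^sub>1) (M\<^sub>2 + N\<^sub>2)"
    using union sets conv_add[of E C N\<^sub>1 N\<^sub>2 M\<^sub>2] by (simp add: add.commute)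
  ultimately show ?case using union sets monomials_add conv_trans by blast
next
  case (sym s t)
  then show ?case using conv_sym by blast
next
  case (trans s t u)
  then show ?case using conv_trans by blast
qed simp

section \<open>Completion preserves connectedness of peaks\<close>

locale admissible_order =
  fixes C :: "'c set" and gt :: "'c multiset \<Rightarrow> 'c multiset \<Rightarrow> bool"
  assumes adm: "admissible C gt"
begin

abbreviation Mon :: "'c multiset set" where "Mon \<equiv> monomials C"

lemma gt_trans: "\<lbrakk>gt L M; gt M N; L \<in> Mon; M \<in> Mon; N \<in> Mon\<rbrakk> \<Longrightarrow> gt L N"
  using adm unfolding admissible_def strict_total_order_on_def by (auto dest: transp_onD)

lemma gt_total: "\<lbrakk>M \<noteq> N; M \<in> Mon; N \<in> Mon\<rbrakk> \<Longrightarrow> gt M N \<or> gt N M"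
  using adm unfolding admissible_def strict_total_order_on_def by (auto dest: totalp_onD)

lemma gt_add: "\<lbrakk>gt M N; M \<in> Mon; N \<in> Mon; set_mset X \<subseteq> C\<rbrakk> \<Longrightarrow> gt (M + X) (N + X)"
  using adm unfolding admissible_def by blast

lemma gt_induct [consumes 1, case_names less]:
  assumes "M \<in> Mon" and "\<And>M. M \<in> Mon \<Longrightarrow> (\<And>N. N \<in> Mon \<Longrightarrow> gt M N \<Longrightarrow> P N) \<Longrightarrow> P M"
  shows "P M"
proof -
  have "wfp_on Mon gt\<inverse>\<inverse>" using adm by (simp add: admissible_def)
  then have "(\<forall>x\<in>Mon. (\<forall>y\<in>Mon. gt x y \<longrightarrow> P y) \<longrightarrow> P x) \<longrightarrow> (\<forall>x\<in>Mon. P x)"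
    unfolding wfp_on_def conversep_iff by (rule spec)
  then show ?thesis using assms by blast
qed

lemma rstep_gt:
  assumes "rstep C R M N" and "oriented C gt R"
  shows "M \<in> Mon" and "N \<in> Mon" and "gt M N"
proof -
  obtain A B where AB: "(A, B) \<in> R" "A \<subseteq># M" "N = (M - A) + B" and M: "M \<in> Mon"
    using assms(1) by (auto simp: rstep_def)
  note o = orientedD[OF assms(2) AB(1)]
  have X: "set_mset (M - A) \<subseteq> C" using M by (auto simp: monomials_def dest: in_diffD)
  have "M = A + (M - A)" using AB(2) by simp
  then show "gt M N" using gt_add[OF o(3,1,2) X] AB(3) by (simp add: add.commute)
  show "M \<in> Mon" "N \<in> Mon" using M AB(3) o(2) monomials_diff_add by auto
qed

lemma rsteps_monomials:
  "(rstep C R)\<^sup>*\<^sup>* M N \<Longrightarrow> oriented C gt R \<Longrightarrow> M \<in> Mon \<Longrightarrow> N \<in> Mon"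
  by (induction rule: rtranclp_induct) (auto dest: rstep_gt)

lemma wfP_rstep:
  assumes "oriented C gt R"
  shows "wfP (rstep C R)\<inverse>\<inverse>"
proof -
  have acc: "M \<in> Mon \<Longrightarrow> Wellfounded.accp (rstep C R)\<inverse>\<inverse> M" for M
  proof (induction M rule: gt_induct)
    case (less M)
    show ?case
    proof (rule accpI)
      fix N assume "(rstep C R)\<inverse>\<inverse> N M"
      then have "rstep C R M N" by simp
      note rstep_gt[OF this assms]
      then show "Wellfounded.accp (rstep C R)\<inverse>\<inverse> N" using less.IH by blast
    qed
  qed
  have "Wellfounded.accp (rstep C R)\<inverse>\<inverse> M" for M
  \<comment> \<open>The relation lives on the whole type; a multiset outside \<open>Mon\<close> has
    no step and is trivially accessible.\<close>
  proof (cases "M \<in> Mon")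
    case False
    then have "\<not> rstep C R M N" for N by (simp add: rstep_def)
    then show ?thesis by (blast intro: accpI)
  qed (rule acc)
  then show ?thesis using accp_wfpI by blast
qed

lemma NF_exists:
  assumes "oriented C gt R" and "M \<in> Mon"
  shows "\<exists>N. NF C R M N"
  using assms(2)
proof (induction M rule: gt_induct)
  case (less M)
  show ?case
  proof (cases "reducible C R M")
    case True
    then obtain N where N: "rstep C R M N" by (auto simp: reducible_def)
    then obtain K where "NF C R N K" using less.IH rstep_gt[OF N assms(1)] by blast
    then show ?thesis using N by (auto simp: NF_def intro: converse_rtranclp_into_rtranclp)
  qed (auto simp: NF_def)
qed

text \<open>Rewriting from a member never leaves such a set. The notion covers both
  \<open>Mon\<close> and \<open>below M\<close>, so one replacement argument preserves the theory
  and the connectedness of peaks alike.\<close>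

definition down_closed :: "'c multiset set \<Rightarrow> bool" where
  "down_closed D \<longleftrightarrow> D \<subseteq> Mon \<and> (\<forall>a\<in>D. \<forall>b\<in>Mon. gt a b \<longrightarrow> b \<in> D)"

definition below :: "'c multiset \<Rightarrow> 'c multiset set" where
  "below M = {N \<in> Mon. gt M N}"

lemma down_closed_Mon: "down_closed Mon"
  by (simp add: down_closed_def)

lemma down_closed_below: "M \<in> Mon \<Longrightarrow> down_closed (below M)"
  by (auto simp: down_closed_def below_def intro: gt_trans)

lemma below_subset: "down_closed D \<Longrightarrow> M \<in> D \<Longrightarrow> below M \<subseteq> D"
  by (auto simp: down_closed_def below_def)

lemma rsteps_conv:
  assumes "(rstep C R)\<^sup>*\<^sup>* s t" and R: "oriented C gt R" and D: "down_closed D" and s: "s \<in> D"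
  shows "t \<in> D \<and> conv R D s t"
  using assms(1)
proof (induction rule: rtranclp_induct)
  case (step y z)
  then obtain A B where AB: "(A, B) \<in> R" "A \<subseteq># y" "z = (y - A) + B"
    by (auto simp: rstep_def)
  have z: "z \<in> D"
    using D step.IH rstep_gt[OF step.hyps(2) R] by (auto simp: down_closed_def)
  have "y = A + (y - A)" "z = B + (y - A)" using AB by (auto simp: add.commute)
  then have "conv R D y z"
    using conv_eq[OF AB(1), of "y - A" D] z step.IH by simp
  then show ?case using z step.IH conv_trans by blast
qed (use s in simp)

lemma rsteps_add_conv:
  assumes "(rstep C R)\<^sup>*\<^sup>* s t" and "oriented C gt R" and "down_closed D" and "s + X \<in> D"
  shows "t + X \<in> D \<and> conv R D (s + X) (t + X)"
proof -
  have "s + X \<in> Mon" using assms(3,4) by (auto simp: down_closed_def)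
  then have "set_mset X \<subseteq> C" by (simp add: monomials_def)
  then show ?thesis using rsteps_conv[OF rsteps_add[OF assms(1)] assms(2-)] by blast
qed

lemma rule_down:
  assumes "oriented C gt R" and "(l, r) \<in> R" and "down_closed D" and "l + X \<in> D"
  shows "r + X \<in> D" and "r + X \<in> below (l + X)"
proof -
  have "l + X \<in> Mon" using assms(3,4) by (auto simp: down_closed_def)
  then have X: "set_mset X \<subseteq> C" by (simp add: monomials_def)
  note o = orientedD[OF assms(1,2)]
  show "r + X \<in> below (l + X)"
    unfolding below_def using gt_add[OF o(3,1,2) X] monomials_add[OF o(2) X] by simp
  then show "r + X \<in> D" using below_subset[OF assms(3,4)] by blast
qed

section \<open>Local peaks connected below their source, and confluence\<close>

definition peaks_connected :: "'c rules \<Rightarrow> 'c rules \<Rightarrow> bool" where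
  "peaks_connected R E \<longleftrightarrow>
     (\<forall>M a b. rstep C R M a \<longrightarrow> rstep C R M b \<longrightarrow> conv E (below M) a b)"

lemma joinable_conv:
  assumes "rstep C R M a" and "rstep C R M b" and "oriented C gt R"
    and "(rstep C R)\<^sup>*\<^sup>* a u" and "(rstep C R)\<^sup>*\<^sup>* b u"
  shows "conv R (below M) a b"
proof -
  note a = rstep_gt[OF assms(1,3)] and b = rstep_gt[OF assms(2,3)]
  have "a \<in> below M" "b \<in> below M" using a b by (auto simp: below_def)
  then show ?thesis
    using rsteps_conv[OF assms(4,3) down_closed_below[OF a(1)]]
      rsteps_conv[OF assms(5,3) down_closed_below[OF a(1)]]
    using conv_trans conv_sym by metis
qed

text \<open>The Church-Rosser argument, asking for confluence at members of \<open>D\<close> only.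
  Inside the induction that proves confluence, this is known just for
  \<open>D = below M\<close>.\<close>

lemma conv_imp_joinable:
  assumes D: "D \<subseteq> Mon"
    and CR: "\<And>x a b. x \<in> D \<Longrightarrow> (rstep C R)\<^sup>*\<^sup>* x a \<Longrightarrow> (rstep C R)\<^sup>*\<^sup>* x b \<Longrightarrow>
      \<exists>u. (rstep C R)\<^sup>*\<^sup>* a u \<and> (rstep C R)\<^sup>*\<^sup>* b u"
    and "conv R D s t"
  shows "\<exists>u. (rstep C R)\<^sup>*\<^sup>* s u \<and> (rstep C R)\<^sup>*\<^sup>* t u"
  using assms(3) unfolding conv_def
proof (induction rule: rtranclp_induct)
  case (step y z)
  then obtain u where u: "(rstep C R)\<^sup>*\<^sup>* s u" "(rstep C R)\<^sup>*\<^sup>* y u" by blast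
  have y: "y \<in> D" using step.hyps(2) by (simp add: estep_def)
  have "rstep C R y z \<or> rstep C R z y"
    using step.hyps(2) D by (auto simp: estep_def intro: rstep_rule_add)
  then show ?case
  proof
    assume "rstep C R y z"
    then obtain v where "(rstep C R)\<^sup>*\<^sup>* u v" "(rstep C R)\<^sup>*\<^sup>* z v"
      using CR[OF y u(2), of z] by blast
    then show ?case using rtranclp_trans[OF u(1)] by blast
  next
    assume "rstep C R z y"
    then show ?case using u converse_rtranclp_into_rtranclp by metis
  qed
qed auto

text \<open>Newman's lemma with joinability of local peaks weakened to connectedness below the peak,
  as in the criterion of Winkler and Buchberger. The induction hypothesis gives confluence at every
  member of the chain between two reducts of \<open>M\<close>, so these have a common
  reduct.\<close>

lemma peaks_connected_imp_confluent:
  assumes R: "oriented C gt R" and pc: "peaks_connected R R"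
  shows "confluentp (rstep C R)"
proof -
  let ?join = "\<lambda>a b. \<exists>u. (rstep C R)\<^sup>*\<^sup>* a u \<and> (rstep C R)\<^sup>*\<^sup>* b u"
  let ?CR = "\<lambda>M. \<forall>a b. (rstep C R)\<^sup>*\<^sup>* M a \<longrightarrow> (rstep C R)\<^sup>*\<^sup>* M b \<longrightarrow> ?join a b"
  have CR: "M \<in> Mon \<Longrightarrow> ?CR M" for M
  proof (induction M rule: gt_induct)
    case (less M)
    have IH: "?CR x" if "x \<in> below M" for x
      using that less.IH by (auto simp: below_def)
    have "?join a b" if a: "(rstep C R)\<^sup>*\<^sup>* M a" and b: "(rstep C R)\<^sup>*\<^sup>* M b" for a b
    proof (cases "M = a \<or> M = b")
      case True
      then show ?thesis using a b by blast
    next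
      case False
      obtain a' b' where a': "rstep C R M a'" "(rstep C R)\<^sup>*\<^sup>* a' a"
        and b': "rstep C R M b'" "(rstep C R)\<^sup>*\<^sup>* b' b"
        using a b False by (metis converse_rtranclpE)
      have below: "a' \<in> below M" "b' \<in> below M"
        using rstep_gt[OF a'(1) R] rstep_gt[OF b'(1) R] by (auto simp: below_def)
      have "conv R (below M) a' b'" using pc a' b' by (auto simp: peaks_connected_def)
      then obtain u where u: "(rstep C R)\<^sup>*\<^sup>* a' u" "(rstep C R)\<^sup>*\<^sup>* b' u"
        using conv_imp_joinable[of "below M" R a' b'] IH unfolding below_def by blast
      \<comment> \<open>The peak at \<open>a'\<close> joins \<open>a\<close> with \<open>u\<close>
        in \<open>v\<close>; the peak at \<open>b'\<close> then joins \<open>b\<close> with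
        \<open>v\<close>.\<close>
      obtain v where v: "(rstep C R)\<^sup>*\<^sup>* a v" "(rstep C R)\<^sup>*\<^sup>* u v"
        using IH[OF below(1)] a'(2) u(1) by blast
      then obtain w where "(rstep C R)\<^sup>*\<^sup>* v w" "(rstep C R)\<^sup>*\<^sup>* b w"
        using IH[OF below(2)] b'(2) rtranclp_trans[OF u(2) v(2)] by blast
      then show ?thesis using v(1) by (meson rtranclp_trans)
    qed
    then show ?case by blast
  qed
  show ?thesis
  proof (rule confluentpI)
    fix x y z assume xy: "(rstep C R)\<^sup>*\<^sup>* x y" and xz: "(rstep C R)\<^sup>*\<^sup>* x z"
    show "?join y z"
    proof (cases "x \<in> Mon")
      case False
      then have "y = x" "z = x"
        using xy xz by (metis converse_rtranclpE rstep_def)+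
      then show ?thesis by blast
    qed (use CR xy xz in blast)
  qed
qed

lemma conv_imp_same_NF:
  assumes R: "oriented C gt R" and cr: "confluentp (rstep C R)"
    and "conv R Mon s t" and "s \<in> Mon"
  shows "\<exists>u. NF C R s u \<and> NF C R t u"
proof -
  have "\<exists>u. (rstep C R)\<^sup>*\<^sup>* s u \<and> (rstep C R)\<^sup>*\<^sup>* t u"
    using conv_imp_joinable[OF subset_refl confluentpD[OF cr] assms(3)] .
  then obtain u where u: "(rstep C R)\<^sup>*\<^sup>* s u" "(rstep C R)\<^sup>*\<^sup>* t u" by blast
  obtain n where "NF C R u n"
    using NF_exists[OF R] rsteps_monomials[OF u(1) R assms(4)] by blast
  then show ?thesis using u unfolding NF_def by (meson rtranclp_trans)
qed


section \<open>Preservation of the invariant by the steps of the procedure\<close>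

lemma conv_replace_iff:
  assumes "\<And>l r X. (l, r) \<in> E \<Longrightarrow> l + X \<in> Mon \<Longrightarrow> r + X \<in> Mon \<Longrightarrow> conv E' Mon (l + X) (r + X)"
    and "\<And>l r. (l, r) \<in> E' \<Longrightarrow> conv E Mon l r"
  shows "conv E Mon s t \<longleftrightarrow> conv E' Mon s t"
proof
  assume "conv E' Mon s t"
  \<comment> \<open>The second assumption has no context \<open>X\<close>; over \<open>Mon\<close>
    it is added by \<open>conv_add\<close>.\<close>
  then show "conv E Mon s t"
  proof (rule conv_replace[rotated])
    fix l r X assume "(l, r) \<in> E'" "l + X \<in> Mon"
    then show "conv E Mon (l + X) (r + X)"
      using assms(2) conv_add[of E C l r X] by (auto simp: monomials_def)
  qed
qed (rule conv_replace[OF assms(1)])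

text \<open>Interreduction is postponed: the new rule joins the unchanged \<open>R\<close>. A peak
  of two old rules is connected already. In a peak of an old and the new rule, the reducts are the
  sides of a critical pair in a context, and these sides rewrite to monomials that are equal or
  equated by \<open>E'\<close>.\<close>

lemma peaks_connected_orient:
  assumes R: "oriented C gt R" and new: "l' \<in> Mon" "r' \<in> Mon" "gt l' r'"
    and pc: "peaks_connected R E"
    and cover: "\<And>D s t. down_closed D \<Longrightarrow> conv E D s t \<Longrightarrow> conv E' D s t"
      "\<And>D s t. down_closed D \<Longrightarrow> conv (insert (l', r') R) D s t \<Longrightarrow> conv E' D s t"
    and crit: "\<And>a b. (a, b) \<in> R \<Longrightarrow> \<exists>n\<^sub>1 n\<^sub>2.
        (rstep C R)\<^sup>*\<^sup>* (fst (critical_pair (l', r') (a, b))) n\<^sub>1 \<and>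
        (rstep C R)\<^sup>*\<^sup>* (snd (critical_pair (l', r') (a, b))) n\<^sub>2 \<and> (n\<^sub>1 = n\<^sub>2 \<or> (n\<^sub>1, n\<^sub>2) \<in> E')"
  shows "peaks_connected (insert (l', r') R) E'"
proof -
  let ?R = "insert (l', r') R"
  have oR: "oriented C gt ?R" using R new by (simp add: oriented_def)
  have mixed: "conv E' (below M) ((M - l') + r') ((M - a) + b)"
    if M: "M \<in> Mon" and l': "l' \<subseteq># M" and ab: "(a, b) \<in> R" "a \<subseteq># M" for M a b
  proof -
    obtain n\<^sub>1 n\<^sub>2 where n: "(rstep C R)\<^sup>*\<^sup>* (fst (critical_pair (l', r') (a, b))) n\<^sub>1"
      "(rstep C R)\<^sup>*\<^sup>* (snd (critical_pair (l', r') (a, b))) n\<^sub>2" "n\<^sub>1 = n\<^sub>2 \<or> (n\<^sub>1, n\<^sub>2) \<in> E'"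
      using crit[OF ab(1)] by blast
    obtain X where X: "(M - l') + r' = fst (critical_pair (l', r') (a, b)) + X"
      "(M - a) + b = snd (critical_pair (l', r') (a, b)) + X"
      using critical_pair_add[OF l' ab(2)] by metis
    have steps: "rstep C ?R M ((M - l') + r')" "rstep C ?R M ((M - a) + b)"
      unfolding rstep_def using M l' ab by blast+
    have D: "down_closed (below M)" using M by (rule down_closed_below)
    have mem: "(M - l') + r' \<in> below M" "(M - a) + b \<in> below M"
      using rstep_gt[OF steps(1) oR] rstep_gt[OF steps(2) oR] by (simp_all add: below_def)
    have c1: "n\<^sub>1 + X \<in> below M" "conv R (below M) ((M - l') + r') (n\<^sub>1 + X)"
      using rsteps_add_conv[OF n(1) R D] mem(1) unfolding X(1) by blast+
    have c2: "n\<^sub>2 + X \<in> below M" "conv R (below M) ((M - a) + b) (n\<^sub>2 + X)"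
      using rsteps_add_conv[OF n(2) R D] mem(2) unfolding X(2) by blast+
    have "conv E' (below M) (n\<^sub>1 + X) (n\<^sub>2 + X)"
      using n(3) conv_eq[of n\<^sub>1 n\<^sub>2 E' X] c1(1) c2(1) by auto
    moreover have "conv E' (below M) ((M - l') + r') (n\<^sub>1 + X)"
      by (rule cover(2)[OF D conv_mono[OF c1(2)]]) auto
    moreover have "conv E' (below M) ((M - a) + b) (n\<^sub>2 + X)"
      by (rule cover(2)[OF D conv_mono[OF c2(2)]]) auto
    ultimately show ?thesis using conv_trans conv_sym by metis
  qed
  have cases: "rstep C R M a \<or> l' \<subseteq># M \<and> a = (M - l') + r'" if "rstep C ?R M a" for M a
    using that unfolding rstep_def by blast
  show ?thesis
    unfolding peaks_connected_def
  proof (intro allI impI)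
    fix M a b assume a: "rstep C ?R M a" and b: "rstep C ?R M b"
    have M: "M \<in> Mon" using a by (simp add: rstep_def)
    have mixed': "conv E' (below M) ((M - l') + r') c" if "rstep C R M c" "l' \<subseteq># M" for c
      using that mixed[OF M] unfolding rstep_def by blast
    \<comment> \<open>A rule has at most one result on a given \<open>M\<close>, so two uses of the
      new rule leave \<open>a = b\<close>.\<close>
    consider "rstep C R M a" "rstep C R M b"
      | "rstep C R M a" "l' \<subseteq># M" "b = (M - l') + r'"
      | "rstep C R M b" "l' \<subseteq># M" "a = (M - l') + r'"
      | "a = b"
      using cases[OF a] cases[OF b] by blast
    then show "conv E' (below M) a b"
    proof cases
      case 1
      then show ?thesis
        using pc cover(1)[OF down_closed_below[OF M]] unfolding peaks_connected_def by blast
    next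
      case 2
      then show ?thesis using mixed' conv_sym by blast
    next
      case 3
      then show ?thesis using mixed' by blast
    qed simp
  qed
qed

text \<open>Everything passes through \<open>insert (l', r') R\<close>, the system before
  interreduction. Its rules, and hence the old equations, are derivable from the new equations in
  every down-closed set; its peaks are therefore connected, and the peaks of \<open>R'\<close> are
  compared with them.\<close>

lemma orient_preserves:
  assumes R: "oriented C gt R" and ST: "S \<union> T \<subseteq> Mon \<times> Mon"
    and pc: "peaks_connected R (R \<union> S \<union> T)"
    and lr: "(l, r) \<in> S" and u: "NF C R l u" and v: "NF C R r v"
    and uv: "(l', r') = (u, v) \<or> (l', r') = (v, u)" and gt: "gt l' r'"
    and n: "\<forall>\<rho>\<in>R. NF C R (fst (critical_pair (l', r') \<rho>)) (n\<^sub>1 \<rho>) \<and>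
           NF C R (snd (critical_pair (l', r') \<rho>)) (n\<^sub>2 \<rho>)"
    and CP: "CP = {(n\<^sub>1 \<rho>, n\<^sub>2 \<rho>) | \<rho>. \<rho> \<in> R \<and> n\<^sub>1 \<rho> \<noteq> n\<^sub>2 \<rho>}"
    and removed: "removed \<subseteq> R"
    and n\<^sub>3: "\<forall>\<rho>\<in>R - removed.
       if reducible C {(l', r')} (snd \<rho>)
       then NF C (insert (l', r') R) (snd \<rho>) (n\<^sub>3 \<rho>)
       else n\<^sub>3 \<rho> = snd \<rho>"
    and R': "R' = insert (l', r') {(fst \<rho>, n\<^sub>3 \<rho>) | \<rho>. \<rho> \<in> R - removed}"
    and T': "T' = T \<union> CP \<union> removed" and S': "S' = S - {(l, r)}"
  shows "oriented C gt R'" and "S' \<union> T' \<subseteq> Mon \<times> Mon"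
    and "peaks_connected R' (R' \<union> S' \<union> T')"
    and "conv (R \<union> S \<union> T) Mon s t \<longleftrightarrow> conv (R' \<union> S' \<union> T') Mon s t"
proof -
  let ?E = "R \<union> S \<union> T" and ?E' = "R' \<union> S' \<union> T'" and ?R = "insert (l', r') R"
  have lu: "(rstep C R)\<^sup>*\<^sup>* l u" and rv: "(rstep C R)\<^sup>*\<^sup>* r v" using u v by (simp_all add: NF_def)
  have lrM: "l \<in> Mon" "r \<in> Mon" using lr ST by auto
  have "u \<in> Mon" "v \<in> Mon" using rsteps_monomials[OF lu R] rsteps_monomials[OF rv R] lrM by auto
  then have new: "l' \<in> Mon" "r' \<in> Mon" using uv by auto
  have uv': "u = l' \<and> v = r' \<or> u = r' \<and> v = l'" using uv by auto
  have oR: "oriented C gt ?R" using R new gt by (simp add: oriented_def)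
  have ret: "(rstep C ?R)\<^sup>*\<^sup>* b (n\<^sub>3 (a, b))" if "(a, b) \<in> R" "(a, b) \<notin> removed" for a b
    using n\<^sub>3 that by (auto simp: NF_def split: if_splits dest!: bspec[of _ _ "(a, b)"])
  \<comment> \<open>Rewriting a right side only lowers it, which keeps the changed rule
    oriented.\<close>
  have ret_below: "n\<^sub>3 (a, b) \<in> below a" if "(a, b) \<in> R" "(a, b) \<notin> removed" for a b
  proof -
    note o = orientedD[OF R that(1)]
    have "b \<in> below a" using o by (simp add: below_def)
    then show ?thesis using rsteps_conv[OF ret[OF that] oR down_closed_below[OF o(1)]] by blast
  qed
  show oR': "oriented C gt R'"
    unfolding oriented_def R' using new gt ret_below orientedD(1)[OF R] by (auto simp: below_def)
  have crit: "\<exists>M. rstep C ?R M (fst (critical_pair (l', r') (a, b))) \<and>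
      rstep C ?R M (snd (critical_pair (l', r') (a, b)))" if "(a, b) \<in> R" for a b
    using critical_pair_rsteps[of l' r' ?R a b C] that new(1) orientedD(1)[OF R that] by blast
  have crit_steps: "(rstep C R)\<^sup>*\<^sup>* (fst (critical_pair (l', r') (a, b))) (n\<^sub>1 (a, b))"
    "(rstep C R)\<^sup>*\<^sup>* (snd (critical_pair (l', r') (a, b))) (n\<^sub>2 (a, b))" if "(a, b) \<in> R" for a b
    using n that by (auto simp: NF_def simp del: critical_pair.simps)
  have CP_conv: "n\<^sub>1 (a, b) \<in> Mon \<and> n\<^sub>2 (a, b) \<in> Mon \<and> conv ?R Mon (n\<^sub>1 (a, b)) (n\<^sub>2 (a, b))"
    if "(a, b) \<in> R" for a b
  proof -
    obtain M where M: "rstep C ?R M (fst (critical_pair (l', r') (a, b)))"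
      "rstep C ?R M (snd (critical_pair (l', r') (a, b)))" using crit[OF \<open>(a, b) \<in> R\<close>] by blast
    have "(rstep C ?R)\<^sup>*\<^sup>* M (n\<^sub>1 (a, b))"
      using M(1) rsteps_mono[OF crit_steps(1)[OF that], of ?R]
      by (simp add: converse_rtranclp_into_rtranclp subset_insertI)
    moreover have "(rstep C ?R)\<^sup>*\<^sup>* M (n\<^sub>2 (a, b))"
      using M(2) rsteps_mono[OF crit_steps(2)[OF that], of ?R]
      by (simp add: converse_rtranclp_into_rtranclp subset_insertI)
    moreover have "M \<in> Mon" using M by (simp add: rstep_def)
    ultimately show ?thesis
      using rsteps_conv[OF _ oR down_closed_Mon, of M] conv_trans conv_sym by metis
  qed
  show "S' \<union> T' \<subseteq> Mon \<times> Mon"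
  proof -
    have "CP \<subseteq> Mon \<times> Mon" unfolding CP using CP_conv by auto
    moreover have "removed \<subseteq> Mon \<times> Mon" using removed orientedD[OF R] by auto
    ultimately show ?thesis using ST unfolding S' T' by blast
  qed
  \<comment> \<open>A rule \<open>(a, b)\<close> with a changed right side is derived from
    \<open>(a, n\<^sub>3 (a, b))\<close> and the rewriting of \<open>b\<close>, which may use rules
    that have changed too. Those are applied only below \<open>a + X\<close>, so induction on the
    instance \<open>M = a + X\<close> works; \<open>D\<close> is generalized because the recursive
    calls take place in \<open>below M\<close>.\<close>
  have rule_cover: "conv ?E' D (a + X) (b + X)"
    if "M \<in> Mon" "M = a + X" "(a, b) \<in> ?R" "down_closed D" "a + X \<in> D" for M D a b X
    using that
  proof (induction M arbitrary: D a b X rule: gt_induct)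
    case (less M D a b X)
    note bX = rule_down[OF oR less.prems(2,3,4)]
    show ?case
    proof (cases "(a, b) = (l', r') \<or> (a, b) \<in> removed")
      case True
      then have "(a, b) \<in> ?E'" unfolding R' T' by auto
      then show ?thesis using conv_eq[OF _ less.prems(4) bX(1)] by simp
    next
      case False
      then have ab: "(a, b) \<in> R" "(a, b) \<notin> removed" using less.prems by auto
      have Mb: "below M \<subseteq> D" and D: "down_closed (below M)"
        using less.prems below_subset less.hyps down_closed_below by auto
      have c: "n\<^sub>3 (a, b) + X \<in> below M" "conv ?R (below M) (b + X) (n\<^sub>3 (a, b) + X)"
        using rsteps_add_conv[OF ret[OF ab] oR D] bX(2) less.prems(1) by auto
      have "conv ?E' (below M) (b + X) (n\<^sub>3 (a, b) + X)"
      proof (rule conv_replace[OF _ c(2)])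
        fix x y Y assume xy: "(x, y) \<in> ?R" "x + Y \<in> below M"
        then have "x + Y \<in> Mon" "gt M (x + Y)" by (simp_all add: below_def)
        then show "conv ?E' (below M) (x + Y) (y + Y)"
          using less.IH[OF _ _ HOL.refl xy(1) D xy(2)] by blast
      qed
      then have "conv ?E' D (b + X) (n\<^sub>3 (a, b) + X)" using conv_mono Mb by blast
      moreover have "conv ?E' D (a + X) (n\<^sub>3 (a, b) + X)"
      proof (rule conv_eq)
        show "(a, n\<^sub>3 (a, b)) \<in> ?E'" unfolding R' using ab by force
      qed (use less.prems c(1) Mb in auto)
      ultimately show ?thesis using conv_trans conv_sym by metis
    qed
  qed
  have cover_R: "conv ?E' D s t" if D: "down_closed D" and "conv ?R D s t" for D s t
  proof (rule conv_replace[OF _ that(2)])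
    fix a b X assume ab: "(a, b) \<in> ?R" "a + X \<in> D"
    then have "a + X \<in> Mon" using D by (auto simp: down_closed_def)
    then show "conv ?E' D (a + X) (b + X)"
      using rule_cover[OF _ HOL.refl ab(1) D ab(2)] by blast
  qed
  \<comment> \<open>\<open>(l, r)\<close> is the only equation taken out of \<open>S\<close>; its
    sides rewrite to \<open>u\<close> and \<open>v\<close>, which the new rule equates.\<close>
  have cover_eq: "conv ?E' D (a + X) (b + X)"
    if D: "down_closed D" and ab: "(a, b) \<in> ?E" and aX: "a + X \<in> D" and bX: "b + X \<in> D" for D a b X
  proof -
    consider "(a, b) \<in> R" | "(a, b) \<in> ?E'" | "a = l" "b = r"
      using ab unfolding S' T' by blast
    then show ?thesis
    proof cases
      case 1
      then show ?thesis using cover_R[OF D] conv_eq[of a b ?R X D] aX bX by auto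
    next
      case 2
      then show ?thesis using aX bX by (rule conv_eq)
    next
      case 3
      have cu: "u + X \<in> D" "conv R D (a + X) (u + X)"
        using rsteps_add_conv[OF lu R D] aX 3 by auto
      have cv: "v + X \<in> D" "conv R D (b + X) (v + X)"
        using rsteps_add_conv[OF rv R D] bX 3 by auto
      have "conv ?R D (u + X) (v + X)"
        using uv' conv_eq[of l' r' ?R X D] cu(1) cv(1) conv_sym insertI1 by metis
      moreover have "conv ?R D (a + X) (u + X)" "conv ?R D (b + X) (v + X)"
        using conv_mono[OF cu(2) subset_insertI subset_refl]
          conv_mono[OF cv(2) subset_insertI subset_refl] .
      ultimately have "conv ?R D (a + X) (b + X)" using conv_trans conv_sym by metis
      then show ?thesis by (rule cover_R[OF D])
    qed
  qed
  have cover: "conv ?E' D s t" if D: "down_closed D" and "conv ?E D s t" for D s t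
    using cover_eq[OF D] that(2) by (rule conv_replace)
  have pcn: "peaks_connected ?R ?E'"
  proof (rule peaks_connected_orient[OF R new gt pc cover cover_R])
    fix a b assume ab: "(a, b) \<in> R"
    have "n\<^sub>1 (a, b) = n\<^sub>2 (a, b) \<or> (n\<^sub>1 (a, b), n\<^sub>2 (a, b)) \<in> ?E'"
      unfolding T' CP using ab by blast
    then show "\<exists>n\<^sub>1 n\<^sub>2. (rstep C R)\<^sup>*\<^sup>* (fst (critical_pair (l', r') (a, b))) n\<^sub>1 \<and>
        (rstep C R)\<^sup>*\<^sup>* (snd (critical_pair (l', r') (a, b))) n\<^sub>2 \<and> (n\<^sub>1 = n\<^sub>2 \<or> (n\<^sub>1, n\<^sub>2) \<in> ?E')"
      using crit_steps[OF ab] by blast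
  qed
  \<comment> \<open>A step of \<open>R'\<close> is compared with the step of the original rule at
    the same left side. The two results differ by rewriting the right side, which happens below
    \<open>M\<close>.\<close>
  have old_step: "\<exists>c. rstep C ?R M c \<and> conv ?E' (below M) c a" if a: "rstep C R' M a" for M a
  proof -
    obtain x y where xy: "(x, y) \<in> R'" "x \<subseteq># M" "a = (M - x) + y" and M: "M \<in> Mon"
      using a unfolding rstep_def by blast
    show ?thesis
    proof (cases "(x, y) = (l', r')")
      case True
      then have "rstep C ?R M a" unfolding rstep_def using xy M by blast
      then show ?thesis using conv_refl by blast
    next
      case False
      then obtain b where b: "(x, b) \<in> R" "(x, b) \<notin> removed" "y = n\<^sub>3 (x, b)"
        using xy(1) unfolding R' by auto
      have s: "rstep C ?R M ((M - x) + b)" unfolding rstep_def using xy M b by blast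
      have D: "down_closed (below M)" using M by (rule down_closed_below)
      have "b + (M - x) \<in> below M" using rstep_gt[OF s oR] by (simp add: below_def add.commute)
      then have "conv ?R (below M) (b + (M - x)) (y + (M - x))"
        using rsteps_add_conv[OF ret[OF b(1,2)] oR D] b(3) by blast
      then have "conv ?E' (below M) ((M - x) + b) a"
        using cover_R[OF D] xy(3) by (simp only: add.commute)
      then show ?thesis using s by blast
    qed
  qed
  show "peaks_connected R' ?E'"
    unfolding peaks_connected_def
  proof (intro allI impI)
    fix M a b assume "rstep C R' M a" "rstep C R' M b"
    then obtain c d where "rstep C ?R M c" "conv ?E' (below M) c a"
      "rstep C ?R M d" "conv ?E' (below M) d b" using old_step by blast
    moreover from this have "conv ?E' (below M) c d"
      using pcn unfolding peaks_connected_def by blast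
    ultimately show "conv ?E' (below M) a b" using conv_trans conv_sym by metis
  qed
  \<comment> \<open>Conversely, the new rule follows from the old equations along \<open>u\<close>,
    \<open>l\<close>, \<open>r\<close>, \<open>v\<close>.\<close>
  have conv_new: "conv ?E Mon u v"
  proof -
    have c: "conv R Mon l u" "conv R Mon r v"
      using rsteps_conv[OF lu R down_closed_Mon] rsteps_conv[OF rv R down_closed_Mon] lrM by auto
    have "R \<subseteq> ?E" by blast
    then have "conv ?E Mon l u" "conv ?E Mon r v"
      using conv_mono[OF c(1) _ subset_refl] conv_mono[OF c(2) _ subset_refl] by simp_all
    moreover have "conv ?E Mon l r" using conv_eq[of l r ?E "{#}" Mon] lr lrM by auto
    ultimately show ?thesis using conv_trans conv_sym by metis
  qed
  have back_R: "conv ?E Mon s t" if "conv ?R Mon s t" for s t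
  proof (rule conv_replace[OF _ that])
    fix a b X assume ab: "(a, b) \<in> ?R" "a + X \<in> Mon" "b + X \<in> Mon"
    have X: "set_mset X \<subseteq> C" using ab(2) by (simp add: monomials_def)
    show "conv ?E Mon (a + X) (b + X)"
    proof (cases "(a, b) = (l', r')")
      case True
      then show ?thesis using uv' conv_add[OF conv_new X] conv_sym by (metis prod.inject)
    next
      case False
      then show ?thesis using conv_eq[of a b ?E X Mon] ab by blast
    qed
  qed
  show "conv ?E Mon s t \<longleftrightarrow> conv ?E' Mon s t"
  proof (rule conv_replace_iff)
    show "conv ?E' Mon (a + X) (b + X)" if "(a, b) \<in> ?E" "a + X \<in> Mon" "b + X \<in> Mon" for a b X
      using cover_eq[OF down_closed_Mon that] .
    fix a b assume "(a, b) \<in> ?E'"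
    then consider "(a, b) \<in> ?E" | "(a, b) = (l', r')" | "(a, b) \<in> CP"
      | c where "(a, c) \<in> R" "(a, c) \<notin> removed" "b = n\<^sub>3 (a, c)"
      unfolding R' S' T' using removed by auto
    then show "conv ?E Mon a b"
    proof cases
      case 1
      then have "a \<in> Mon" "b \<in> Mon" using ST orientedD[OF R] by auto
      then show ?thesis using conv_eq[OF 1, of "{#}" Mon] by simp
    next
      case 2
      then show ?thesis using uv' conv_new conv_sym by (metis prod.inject)
    next
      case 3
      then show ?thesis unfolding CP using CP_conv back_R by auto
    next
      case 4
      note o = orientedD[OF R 4(1)]
      have "rstep C ?R a c" using rstep_rule[of a c ?R C] 4(1) o(1) by blast
      then have "(rstep C ?R)\<^sup>*\<^sup>* a b"
        using ret[OF 4(1,2)] 4(3) by (simp add: converse_rtranclp_into_rtranclp)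
      then show ?thesis using rsteps_conv[OF _ oR down_closed_Mon o(1)] back_R by blast
    qed
  qed
qed

text \<open>\<open>S\<close> and \<open>T\<close> count as equations on a par with the rules, so
  \<open>next_round\<close> leaves the invariant untouched. Finiteness is kept apart in
  \<open>finite_state\<close>, since correctness of finished runs is claimed for infinite
  \<open>R\<^sub>f\<close> as well.\<close>

definition update_inv ::
  "'c rules \<Rightarrow> 'c rules \<times> 'c rules \<times> 'c rules \<times> ('c \<times> 'c) set \<Rightarrow> bool" where
  "update_inv E = (\<lambda>(S, T, R, N). oriented C gt R \<and> S \<union> T \<subseteq> Mon \<times> Mon \<and>
     peaks_connected R (R \<union> S \<union> T) \<and>
     (\<forall>s t. conv E Mon s t \<longleftrightarrow> conv (R \<union> S \<union> T) Mon s t))"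

text \<open>Both sides rewrite downwards to the same \<open>u\<close>, so the rules alone derive
  \<open>(l, r)\<close> in every down-closed set containing the two sides, also under a
  context.\<close>

lemma discard_preserves:
  assumes R: "oriented C gt R" and pc: "peaks_connected R (R \<union> S \<union> T)"
    and u: "NF C R l u" and v: "NF C R r u"
  shows "peaks_connected R (R \<union> (S - {(l, r)}) \<union> T)"
    and "conv (R \<union> S \<union> T) Mon s t \<longleftrightarrow> conv (R \<union> (S - {(l, r)}) \<union> T) Mon s t"
proof -
  let ?E = "R \<union> S \<union> T" and ?E' = "R \<union> (S - {(l, r)}) \<union> T"
  have lu: "(rstep C R)\<^sup>*\<^sup>* l u" and ru: "(rstep C R)\<^sup>*\<^sup>* r u" using u v by (simp_all add: NF_def)
  have cover: "conv ?E' D s t" if D: "down_closed D" and "conv ?E D s t" for D s t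
  proof (rule conv_replace[OF _ that(2)])
    fix a b X assume ab: "(a, b) \<in> ?E" "a + X \<in> D" "b + X \<in> D"
    show "conv ?E' D (a + X) (b + X)"
    proof (cases "(a, b) \<in> ?E'")
      case True
      then show ?thesis using ab(2,3) by (rule conv_eq)
    next
      case False
      then have "a = l" "b = r" using ab(1) by auto
      then have "conv R D (a + X) (u + X)" "conv R D (b + X) (u + X)"
        using rsteps_add_conv[OF lu R D] rsteps_add_conv[OF ru R D] ab(2,3) by auto
      then have "conv R D (a + X) (b + X)" using conv_trans conv_sym by metis
      then show ?thesis by (rule conv_mono) auto
    qed
  qed
  show "peaks_connected R ?E'"
    unfolding peaks_connected_def
  proof (intro allI impI)
    fix M a b assume ab: "rstep C R M a" "rstep C R M b"
    then have "M \<in> Mon" by (simp add: rstep_def)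
    moreover have "conv ?E (below M) a b" using pc ab unfolding peaks_connected_def by blast
    ultimately show "conv ?E' (below M) a b" using cover down_closed_below by blast
  qed
  show "conv ?E Mon s t \<longleftrightarrow> conv ?E' Mon s t"
  proof
    assume "conv ?E' Mon s t"
    then show "conv ?E Mon s t" by (rule conv_mono) auto
  qed (rule cover[OF down_closed_Mon])
qed

lemma update_inv_step:
  assumes "update_step C gt \<sigma> \<tau>" and "update_inv E \<sigma>"
  shows "update_inv E \<tau>"
  using assms
proof (cases rule: update_step.cases)
  case (discard l r S R u T N)
  then show ?thesis
    using assms(2) discard_preserves[of R S T l u r] unfolding update_inv_def by auto
next
  case (orient l r S R u v l' r' n\<^sub>1 n\<^sub>2 CP removed n\<^sub>3 T N)
  have inv: "oriented C gt R" "S \<union> T \<subseteq> Mon \<times> Mon" "peaks_connected R (R \<union> S \<union> T)"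
    "\<And>s t. conv E Mon s t \<longleftrightarrow> conv (R \<union> S \<union> T) Mon s t"
    using assms(2) unfolding orient(1) update_inv_def by auto
  have "removed \<subseteq> R" unfolding orient(11) by blast
  note pres = orient_preserves[OF inv(1-3) orient(3-5,7-10) this orient(12) HOL.refl HOL.refl HOL.refl]
  show ?thesis
    unfolding orient(2) update_inv_def using pres inv(4) by simp
next
  case (next_round T R N)
  then show ?thesis using assms(2) unfolding update_inv_def by auto
qed

section \<open>The initial state\<close>

lemma disjoint_rules_joinable:
  assumes "(l\<^sub>1, r\<^sub>1) \<in> R" and "(l\<^sub>2, r\<^sub>2) \<in> R" and R: "oriented C gt R"
    and M: "M \<in> Mon" "l\<^sub>1 \<subseteq># M" "l\<^sub>2 \<subseteq># M" and "l\<^sub>1 \<inter># l\<^sub>2 = {#}"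
  shows "conv R (below M) ((M - l\<^sub>1) + r\<^sub>1) ((M - l\<^sub>2) + r\<^sub>2)"
proof -
  \<comment> \<open>Left sides without a common constant occur in \<open>M\<close> side by side, so
    the two rules commute.\<close>
  have "l\<^sub>1 + l\<^sub>2 \<subseteq># M"
  proof (rule mset_subset_eqI)
    fix x
    have "count (l\<^sub>1 \<inter># l\<^sub>2) x = 0" using assms(7) by simp
    then have "count l\<^sub>1 x = 0 \<or> count l\<^sub>2 x = 0" by (auto simp: min_def split: if_splits)
    then show "count (l\<^sub>1 + l\<^sub>2) x \<le> count M x"
      using M(2,3) by (auto simp: subseteq_mset_def)
  qed
  then obtain K where K: "M = l\<^sub>1 + l\<^sub>2 + K" by (auto simp: mset_subset_eq_exists_conv)
  have eq: "(M - l\<^sub>1) + r\<^sub>1 = l\<^sub>2 + (K + r\<^sub>1)" "(M - l\<^sub>2) + r\<^sub>2 = l\<^sub>1 + (K + r\<^sub>2)"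
    unfolding K by (simp_all add: ac_simps)
  have steps: "rstep C R M ((M - l\<^sub>1) + r\<^sub>1)" "rstep C R M ((M - l\<^sub>2) + r\<^sub>2)"
    unfolding rstep_def using assms(1,2) M by blast+
  have mon: "l\<^sub>2 + (K + r\<^sub>1) \<in> Mon" "l\<^sub>1 + (K + r\<^sub>2) \<in> Mon"
    using rstep_gt(2)[OF steps(1) R] rstep_gt(2)[OF steps(2) R] unfolding eq by auto
  have "rstep C R ((M - l\<^sub>1) + r\<^sub>1) (r\<^sub>1 + r\<^sub>2 + K)"
    unfolding eq using rstep_rule_add[OF assms(2) mon(1)] by (simp add: ac_simps)
  moreover have "rstep C R ((M - l\<^sub>2) + r\<^sub>2) (r\<^sub>1 + r\<^sub>2 + K)"
    unfolding eq using rstep_rule_add[OF assms(1) mon(2)] by (simp add: ac_simps)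
  ultimately show ?thesis using joinable_conv[OF steps R] by blast
qed

text \<open>Carries joinability under \<open>R\<^sub>C\<close>, whose confluence is given on
  constants, over to the rewriting of monomials.\<close>

lemma rsteps_const_rules:
  assumes "(\<lambda>c d. (c, d) \<in> R\<^sub>C)\<^sup>*\<^sup>* c d" and "oriented C gt (const_rules R\<^sub>C)"
  shows "(rstep C (const_rules R\<^sub>C))\<^sup>*\<^sup>* {#c#} {#d#}"
  using assms(1)
proof (induction rule: rtranclp_induct)
  case (step y z)
  then have "({#y#}, {#z#}) \<in> const_rules R\<^sub>C" by (auto simp: const_rules_def)
  then have "rstep C (const_rules R\<^sub>C) {#y#} {#z#}"
    using rstep_rule orientedD(1)[OF assms(2)] by blast
  then show ?case using step.IH by simp
qed simp

lemma update_inv_init: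
  assumes Rf: "oriented C gt R\<^sub>f" and Rf_conf: "confluentp (rstep C R\<^sub>f)"
    and Rc: "oriented C gt (const_rules R\<^sub>C)" and Rc_conf: "confluentp (\<lambda>c d. (c, d) \<in> R\<^sub>C)"
  shows "update_inv (R\<^sub>f \<union> const_rules R\<^sub>C) (update_init C R\<^sub>f R\<^sub>C)"
proof -
  define K where "K = const_rules R\<^sub>C"
  define S where "S = {(l, r) \<in> R\<^sub>f. \<exists>l'. NF C K l l' \<and> l' \<noteq> l}"
  let ?R = "K \<union> (R\<^sub>f - S)"
  have SR: "S \<subseteq> R\<^sub>f" by (auto simp: S_def)
  have E: "?R \<union> S \<union> {} = R\<^sub>f \<union> K" using SR by blast
  have oK: "oriented C gt K" using Rc by (simp add: K_def)
  have oR: "oriented C gt ?R" using oK Rf by (auto simp: oriented_def)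
  \<comment> \<open>If \<open>c\<close> occurred in \<open>l\<close>, then \<open>l\<close> would be
    reducible by \<open>K\<close>, each of its normal forms would differ from it, and the rule would
    have been moved to \<open>S\<close>.\<close>
  have disj: "{#c#} \<inter># l = {#}" if c: "({#c#}, d) \<in> K" and lr: "(l, r) \<in> R\<^sub>f - S" for c d l r
  proof (rule ccontr)
    assume "{#c#} \<inter># l \<noteq> {#}"
    then have "{#c#} \<subseteq># l" by (auto simp: disjunct_not_in)
    moreover have l: "l \<in> Mon" using orientedD(1)[OF Rf] lr by blast
    ultimately have "reducible C K l" using c unfolding reducible_iff by blast
    moreover obtain n where "NF C K l n" using NF_exists[OF oK l] by blast
    ultimately have "(l, r) \<in> S" using lr unfolding S_def NF_def by blast
    then show False using lr by blast
  qed
  have const: "\<exists>c d. l = {#c#} \<and> r = {#d#} \<and> (c, d) \<in> R\<^sub>C" if "(l, r) \<in> K" for l r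
    using that by (auto simp: K_def const_rules_def)
  have peak: "conv (R\<^sub>f \<union> K) (below M) ((M - l\<^sub>1) + r\<^sub>1) ((M - l\<^sub>2) + r\<^sub>2)"
    if r1: "(l\<^sub>1, r\<^sub>1) \<in> ?R" and r2: "(l\<^sub>2, r\<^sub>2) \<in> ?R" and M: "M \<in> Mon" "l\<^sub>1 \<subseteq># M" "l\<^sub>2 \<subseteq># M"
    for M l\<^sub>1 r\<^sub>1 l\<^sub>2 r\<^sub>2
  proof -
    consider "l\<^sub>1 \<inter># l\<^sub>2 = {#}" | "(l\<^sub>1, r\<^sub>1) \<in> R\<^sub>f" "(l\<^sub>2, r\<^sub>2) \<in> R\<^sub>f"
      | c d e where "l\<^sub>1 = {#c#}" "l\<^sub>2 = {#c#}" "r\<^sub>1 = {#d#}" "r\<^sub>2 = {#e#}" "(c, d) \<in> R\<^sub>C" "(c, e) \<in> R\<^sub>C"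
    proof -
      have "l\<^sub>1 \<inter># l\<^sub>2 = {#} \<or> (l\<^sub>1, r\<^sub>1) \<in> R\<^sub>f \<and> (l\<^sub>2, r\<^sub>2) \<in> R\<^sub>f \<or> (l\<^sub>1, r\<^sub>1) \<in> K \<and> (l\<^sub>2, r\<^sub>2) \<in> K"
        using r1 r2 disj[of _ r\<^sub>1 l\<^sub>2 r\<^sub>2] disj[of _ r\<^sub>2 l\<^sub>1 r\<^sub>1] const[of l\<^sub>1 r\<^sub>1] const[of l\<^sub>2 r\<^sub>2]
        by (auto simp: inf_commute)
      moreover have "l\<^sub>1 = l\<^sub>2 \<or> l\<^sub>1 \<inter># l\<^sub>2 = {#}" if "(l\<^sub>1, r\<^sub>1) \<in> K" "(l\<^sub>2, r\<^sub>2) \<in> K"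
        using const[OF that(1)] const[OF that(2)] by auto
      ultimately show thesis using that const[of l\<^sub>1 r\<^sub>1] const[of l\<^sub>2 r\<^sub>2] by fastforce
    qed
    then show ?thesis
    proof cases
      case 1
      have "?R \<subseteq> R\<^sub>f \<union> K" by blast
      then show ?thesis
        using conv_mono[OF disjoint_rules_joinable[OF r1 r2 oR M 1] _ subset_refl] by blast
    next
      case 2
      have steps: "rstep C R\<^sub>f M ((M - l\<^sub>1) + r\<^sub>1)" "rstep C R\<^sub>f M ((M - l\<^sub>2) + r\<^sub>2)"
        unfolding rstep_def using 2 M by blast+
      \<comment> \<open>The common reduct is reached with all of \<open>R\<^sub>f\<close>, including
        rules now in \<open>S\<close>. The peak is thus connected only because the equations of
        \<open>S\<close> take part in the invariant.\<close>
      obtain u where "(rstep C R\<^sub>f)\<^sup>*\<^sup>* ((M - l\<^sub>1) + r\<^sub>1) u" "(rstep C R\<^sub>f)\<^sup>*\<^sup>* ((M - l\<^sub>2) + r\<^sub>2) u"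
        using confluentpD[OF Rf_conf r_into_rtranclp r_into_rtranclp, OF steps] by blast
      then show ?thesis
        using conv_mono[OF joinable_conv[OF steps Rf] Un_upper1 subset_refl] by blast
    next
      case 3
      have "({#c#}, {#d#}) \<in> K" "({#c#}, {#e#}) \<in> K"
        using 3(5,6) by (auto simp: K_def const_rules_def)
      then have steps: "rstep C K M ((M - l\<^sub>1) + r\<^sub>1)" "rstep C K M ((M - l\<^sub>2) + r\<^sub>2)"
        unfolding rstep_def using 3 M by blast+
      obtain x where "(\<lambda>c d. (c, d) \<in> R\<^sub>C)\<^sup>*\<^sup>* d x" "(\<lambda>c d. (c, d) \<in> R\<^sub>C)\<^sup>*\<^sup>* e x"
        using confluentpD[OF Rc_conf r_into_rtranclp r_into_rtranclp, of c d e] 3(5,6) by blast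
      then have dx: "(rstep C K)\<^sup>*\<^sup>* r\<^sub>1 {#x#}" "(rstep C K)\<^sup>*\<^sup>* r\<^sub>2 {#x#}"
        unfolding K_def 3(3,4) using rsteps_const_rules Rc by blast+
      have "set_mset (M - {#c#}) \<subseteq> C" using M(1) by (auto simp: monomials_def dest: in_diffD)
      then have "(rstep C K)\<^sup>*\<^sup>* ((M - l\<^sub>1) + r\<^sub>1) ((M - {#c#}) + {#x#})"
        "(rstep C K)\<^sup>*\<^sup>* ((M - l\<^sub>2) + r\<^sub>2) ((M - {#c#}) + {#x#})"
        unfolding 3(1,2) using rsteps_add[OF dx(1)] rsteps_add[OF dx(2)]
        by (metis add.commute)+
      then show ?thesis
        using conv_mono[OF joinable_conv[OF steps oK] Un_upper2 subset_refl] by blast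
    qed
  qed
  have pc: "peaks_connected ?R (R\<^sub>f \<union> K)"
    unfolding peaks_connected_def
  proof (intro allI impI)
    fix M a b assume "rstep C ?R M a" "rstep C ?R M b"
    then obtain l\<^sub>1 r\<^sub>1 l\<^sub>2 r\<^sub>2 where "M \<in> Mon" "(l\<^sub>1, r\<^sub>1) \<in> ?R" "l\<^sub>1 \<subseteq># M" "a = (M - l\<^sub>1) + r\<^sub>1"
      "(l\<^sub>2, r\<^sub>2) \<in> ?R" "l\<^sub>2 \<subseteq># M" "b = (M - l\<^sub>2) + r\<^sub>2"
      unfolding rstep_def by blast
    then show "conv (R\<^sub>f \<union> K) (below M) a b" using peak by blast
  qed
  have init: "update_init C R\<^sub>f R\<^sub>C = (S, {}, ?R, {})"
    unfolding update_init_def S_def K_def Let_def ..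
  have "S \<subseteq> Mon \<times> Mon" using SR orientedD[OF Rf] by auto
  then show ?thesis
    unfolding init update_inv_def case_prod_conv E using oR pc by (simp add: K_def)
qed

section \<open>Canonicity of final states, and progress from all others\<close>

lemma canonical_for_final:
  assumes "update_inv E ({}, {}, R, N)" and E: "E \<subseteq> Mon \<times> Mon"
  shows "canonical_for C gt (ACCC C E) R"
proof -
  have R: "oriented C gt R" and pc: "peaks_connected R R"
    and eq: "\<And>s t. conv E Mon s t \<longleftrightarrow> conv R Mon s t"
    using assms(1) by (simp_all add: update_inv_def)
  have cr: "confluentp (rstep C R)" using R pc by (rule peaks_connected_imp_confluent)
  have "(s, t) \<in> ACCC C E \<longleftrightarrow> (\<exists>u. NF C R s u \<and> NF C R t u)" if s: "s \<in> Mon" and t: "t \<in> Mon" for s t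
  proof
    assume "(s, t) \<in> ACCC C E"
    then have "conv R Mon s t" using ACCC_imp_conv[OF _ E] eq by blast
    then show "\<exists>u. NF C R s u \<and> NF C R t u" using conv_imp_same_NF[OF R cr] s by blast
  next
    assume "\<exists>u. NF C R s u \<and> NF C R t u"
    then obtain u where "(rstep C R)\<^sup>*\<^sup>* s u" "(rstep C R)\<^sup>*\<^sup>* t u" by (auto simp: NF_def)
    then have "conv R Mon s u" "conv R Mon t u"
      using rsteps_conv[OF _ R down_closed_Mon] s t by blast+
    then have "conv E Mon s t" unfolding eq using conv_trans conv_sym by metis
    then show "(s, t) \<in> ACCC C E" using conv_imp_ACCC[OF _ E s] by blast
  qed
  then show ?thesis
    unfolding canonical_for_def canonical_def using R cr wfP_rstep[OF R] by blast
qed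

text \<open>Normal forms exist because the rules are oriented, and totality of the ordering orients
  two distinct ones. With termination, this yields a run that returns.\<close>

lemma update_step_exists:
  assumes "update_inv E (S, T, R, N)" and "\<not> (S = {} \<and> T = {})"
  shows "\<exists>\<tau>. update_step C gt (S, T, R, N) \<tau>"
proof (cases "S = {}")
  case True
  then have "T \<noteq> {}" using assms(2) by blast
  then show ?thesis unfolding True by (intro exI) (rule update_step.next_round)
next
  case False
  then obtain l r where lr: "(l, r) \<in> S" by (metis ex_in_conv surj_pair)
  have R: "oriented C gt R" and ST: "S \<union> T \<subseteq> Mon \<times> Mon"
    using assms(1) by (simp_all add: update_inv_def)
  have lrM: "l \<in> Mon" "r \<in> Mon" using lr ST by auto
  obtain u v where u: "NF C R l u" and v: "NF C R r v" using NF_exists[OF R] lrM by blast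
  show ?thesis
  proof (cases "u = v")
    case True
    then show ?thesis using update_step.discard[OF lr u] v by blast
  next
    case neq: False
    have uvM: "u \<in> Mon" "v \<in> Mon"
      using u v rsteps_monomials[OF _ R] lrM unfolding NF_def by blast+
    obtain l' r' where l'r': "(l', r') = (u, v) \<or> (l', r') = (v, u)" "gt l' r'"
      using gt_total[OF neq uvM] by blast
    have new: "l' \<in> Mon" "r' \<in> Mon" using l'r'(1) uvM by auto
    let ?R = "insert (l', r') R"
    have oR: "oriented C gt ?R" using R new l'r'(2) by (simp add: oriented_def)
    \<comment> \<open>Both sides of a critical pair are reducts of a common monomial, hence
      monomials, so they have normal forms.\<close>
    have "\<exists>n. NF C R (fst (critical_pair (l', r') \<rho>)) n" "\<exists>n. NF C R (snd (critical_pair (l', r') \<rho>)) n"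
      if \<rho>_R: "\<rho> \<in> R" for \<rho>
    proof -
      obtain a b where \<rho>: "\<rho> = (a, b)" by (cases \<rho>)
      have "a \<in> Mon" using orientedD(1)[OF R] \<rho>_R \<rho> by blast
      then obtain M where "rstep C ?R M (fst (critical_pair (l', r') \<rho>))"
        "rstep C ?R M (snd (critical_pair (l', r') \<rho>))"
        using critical_pair_rsteps[of l' r' ?R a b C] \<rho>_R new(1) unfolding \<rho> by blast
      then show "\<exists>n. NF C R (fst (critical_pair (l', r') \<rho>)) n"
        "\<exists>n. NF C R (snd (critical_pair (l', r') \<rho>)) n"
        using NF_exists[OF R] rstep_gt(2)[OF _ oR] by blast+
    qed
    then obtain n\<^sub>1 n\<^sub>2 where n: "\<forall>\<rho>\<in>R. NF C R (fst (critical_pair (l', r') \<rho>)) (n\<^sub>1 \<rho>) \<and>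
           NF C R (snd (critical_pair (l', r') \<rho>)) (n\<^sub>2 \<rho>)"
      by metis
    define n\<^sub>3 where "n\<^sub>3 \<rho> = (if reducible C {(l', r')} (snd \<rho>)
      then SOME n. NF C ?R (snd \<rho>) n else snd \<rho>)" for \<rho> :: "'c multiset \<times> 'c multiset"
    have n\<^sub>3: "if reducible C {(l', r')} (snd \<rho>) then NF C ?R (snd \<rho>) (n\<^sub>3 \<rho>) else n\<^sub>3 \<rho> = snd \<rho>"
      if "\<rho> \<in> R" for \<rho>
    proof -
      have "snd \<rho> \<in> Mon" using orientedD(2)[OF R, of "fst \<rho>" "snd \<rho>"] that by simp
      then have "NF C ?R (snd \<rho>) (SOME n. NF C ?R (snd \<rho>) n)"
        using NF_exists[OF oR] by (metis someI_ex)
      then show ?thesis by (simp add: n\<^sub>3_def)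
    qed
    show ?thesis
      using update_step.orient[where gt = gt and n\<^sub>1 = n\<^sub>1 and n\<^sub>2 = n\<^sub>2 and n\<^sub>3 = n\<^sub>3,
          OF lr u v neq l'r' n HOL.refl HOL.refl] n\<^sub>3
      by blast
  qed
qed

section \<open>The termination measure\<close>

lemma orient_reducible_strict:
  assumes R: "oriented C gt R" and l': "l' \<in> Mon" "\<not> reducible C R l'"
    and removed: "removed = {\<rho> \<in> R. reducible C {(l', r')} (fst \<rho>)}"
    and R': "R' = insert (l', r') {(fst \<rho>, n\<^sub>3 \<rho>) | \<rho>. \<rho> \<in> R - removed}"
  shows "{M. reducible C R M} \<subset> {M. reducible C R' M}"
proof
  show "{M. reducible C R M} \<subseteq> {M. reducible C R' M}"
  proof
    fix M assume "M \<in> {M. reducible C R M}"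
    then obtain a b where ab: "(a, b) \<in> R" "a \<subseteq># M" and M: "M \<in> Mon"
      unfolding reducible_iff by blast
    have "\<exists>(l, r)\<in>R'. l \<subseteq># M"
    proof (cases "(a, b) \<in> removed")
      case True
      \<comment> \<open>Whatever a removed rule could reduce contains \<open>l'\<close>, so the new
        rule takes over.\<close>
      then have "l' \<subseteq># a" unfolding removed reducible_iff by simp
      then have "l' \<subseteq># M" using ab(2) by (rule subset_mset.order_trans)
      then show ?thesis unfolding R' by blast
    next
      case False
      then have "(a, n\<^sub>3 (a, b)) \<in> R'" unfolding R' using ab(1) by force
      then show ?thesis using ab(2) by blast
    qed
    then show "M \<in> {M. reducible C R' M}" using M by (simp add: reducible_iff)
  qed
  \<comment> \<open>Strictness is witnessed by \<open>l'\<close> itself, which \<open>R\<close>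
    could not reduce.\<close>
  have "reducible C R' l'" using l'(1) unfolding reducible_iff R' by auto
  then show "{M. reducible C R M} \<noteq> {M. reducible C R' M}" using l'(2) by blast
qed

definition finite_state :: "'c rules \<times> 'c rules \<times> 'c rules \<times> ('c \<times> 'c) set \<Rightarrow> bool" where
  "finite_state = (\<lambda>(S, T, R, N). finite S \<and> finite T \<and> finite R)"

text \<open>The weight 2 on the second component makes \<open>S := T\<close>, \<open>T := \<emptyset>\<close> decreasing for \<open>T \<noteq> \<emptyset>\<close>.\<close>

definition pending :: "'c rules \<times> 'c rules \<times> 'c rules \<times> ('c \<times> 'c) set \<Rightarrow> nat" where
  "pending = (\<lambda>(S, T, R, N). card S + 2 * card T)"

definition reducibles :: "'c rules \<times> 'c rules \<times> 'c rules \<times> ('c \<times> 'c) set \<Rightarrow> 'c multiset set" where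
  "reducibles = (\<lambda>(S, T, R, N). {M. reducible C R M})"

text \<open>Lexicographic descent: \<open>orient\<close> may enlarge \<open>T\<close>, but it makes
  more monomials reducible because the new left side is a normal form for \<open>R\<close>. The
  other two steps keep \<open>R\<close> and lower \<open>pending\<close>.\<close>

lemma update_step_decreases:
  assumes "update_step C gt \<sigma> \<tau>" and "update_inv E \<sigma>" and "finite_state \<sigma>"
  shows "finite_state \<tau> \<and>
    (reducibles \<sigma> \<subset> reducibles \<tau> \<or> reducibles \<sigma> = reducibles \<tau> \<and> pending \<tau> < pending \<sigma>)"
  using assms(1)
proof (cases rule: update_step.cases)
  case (discard l r S R u T N)
  then have "finite S" using assms(3) by (simp add: finite_state_def)
  then have "card (S - {(l, r)}) < card S" using discard(3) by (rule card_Diff1_less)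
  then show ?thesis
    using assms(3) discard(1,2) by (simp add: finite_state_def pending_def reducibles_def)
next
  case (orient l r S R u v l' r' n\<^sub>1 n\<^sub>2 CP removed n\<^sub>3 T N)
  have fin: "finite S" "finite T" "finite R"
    using assms(3) unfolding orient(1) finite_state_def by auto
  have R: "oriented C gt R" and ST: "S \<union> T \<subseteq> Mon \<times> Mon"
    using assms(2) unfolding orient(1) update_inv_def by auto
  have lrM: "l \<in> Mon" "r \<in> Mon" using orient(3) ST by auto
  have "u \<in> Mon" "v \<in> Mon" "\<not> reducible C R u" "\<not> reducible C R v"
    using orient(4,5) rsteps_monomials[OF _ R] lrM unfolding NF_def by blast+
  then have "l' \<in> Mon" "\<not> reducible C R l'" using orient(7) by auto
  then have "reducibles \<sigma> \<subset> reducibles \<tau>"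
    using orient_reducible_strict[OF R _ _ orient(11) HOL.refl] unfolding orient(1,2) reducibles_def
    by simp
  moreover have "CP \<subseteq> (\<lambda>\<rho>. (n\<^sub>1 \<rho>, n\<^sub>2 \<rho>)) ` R" unfolding orient(10) by blast
  then have "finite CP" using fin(3) finite_surj by blast
  moreover have "finite removed" unfolding orient(11) using fin(3) by simp
  moreover have "{(fst \<rho>, n\<^sub>3 \<rho>) | \<rho>. \<rho> \<in> R - removed} \<subseteq> (\<lambda>\<rho>. (fst \<rho>, n\<^sub>3 \<rho>)) ` R" by blast
  then have "finite {(fst \<rho>, n\<^sub>3 \<rho>) | \<rho>. \<rho> \<in> R - removed}" using fin(3) finite_surj by blast
  ultimately show ?thesis
    using fin(1,2) unfolding orient(2) finite_state_def case_prod_conv by blast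
next
  case (next_round T R N)
  then have "finite T" "card T > 0" using assms(3) by (auto simp: finite_state_def card_gt_0_iff)
  then show ?thesis
    using assms(3) next_round(1,2) by (simp add: finite_state_def pending_def reducibles_def)
qed

end

section \<open>Termination by Dickson's lemma\<close>

lemma nat_seq_nondecreasing_subseq:
  fixes f :: "nat \<Rightarrow> nat"
  shows "\<exists>g :: nat \<Rightarrow> nat. strict_mono g \<and> incseq (f \<circ> g)"
proof -
  obtain g where g: "strict_mono g" "monoseq (\<lambda>n. f (g n))" using seq_monosub[of f] by blast
  consider "incseq (f \<circ> g)" | "decseq (f \<circ> g)" using g(2) by (auto simp: monoseq_iff comp_def)
  then show ?thesis
  proof cases
    case 2
    \<comment> \<open>A nonincreasing sequence of naturals is constant from an index
      \<open>k\<close> of its least value on, so that tail is also nondecreasing.\<close>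
    obtain k where k: "\<And>n. f (g k) \<le> f (g n)"
      using ex_has_least_nat[of "\<lambda>_. True" 0 "\<lambda>n. f (g n)"] by blast
    have "f (g (k + n)) = f (g k)" for n
      using k[of "k + n"] decseqD[OF 2, of k "k + n"] by (simp add: comp_def)
    then have "incseq (f \<circ> (\<lambda>n. g (k + n)))" by (simp add: incseq_def)
    moreover have "strict_mono (\<lambda>n. g (k + n))" using g(1) by (simp add: strict_mono_def)
    ultimately show ?thesis by blast
  qed (use g in blast)
qed

text \<open>Induction on the alphabet: the subsequence found for \<open>C\<close> is thinned out
  once more for \<open>c\<close>, and this keeps the counts of the earlier constants
  nondecreasing.\<close>

lemma dickson_subseq:
  fixes x :: "nat \<Rightarrow> 'c multiset"
  assumes "finite C"
  shows "\<exists>g :: nat \<Rightarrow> nat. strict_mono g \<and> (\<forall>c\<in>C. incseq (\<lambda>i. count (x (g i)) c))"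
  using assms
proof (induction C)
  case empty
  then show ?case using strict_mono_id by blast
next
  case (insert c C)
  then obtain g where g: "strict_mono g" "\<forall>c\<in>C. incseq (\<lambda>i. count (x (g i)) c)" by blast
  obtain h where h: "strict_mono h" "incseq ((\<lambda>i. count (x (g i)) c) \<circ> h)"
    using nat_seq_nondecreasing_subseq by blast
  have "incseq (\<lambda>i. count (x ((g \<circ> h) i)) d)" if "d \<in> insert c C" for d
  proof (cases "d = c")
    case True
    then show ?thesis using h(2) by (simp add: comp_def)
  next
    case False
    then have "incseq (\<lambda>i. count (x (g i)) d)" using g(2) that by blast
    then show ?thesis using strict_mono_mono[OF h(1)] by (auto simp: incseq_def mono_def)
  qed
  then show ?case using strict_mono_o[OF g(1) h(1)] by blast
qed

lemma dickson:
  fixes x :: "nat \<Rightarrow> 'c multiset"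
  assumes "finite C" and "\<And>i. set_mset (x i) \<subseteq> C"
  shows "\<exists>i j. i < j \<and> x i \<subseteq># x j"
proof -
  obtain g where g: "strict_mono g" "\<forall>c\<in>C. incseq (\<lambda>i. count (x (g i)) c)"
    using dickson_subseq[OF assms(1)] by blast
  have "x (g 0) \<subseteq># x (g 1)"
  proof (rule mset_subset_eqI)
    fix c
    show "count (x (g 0)) c \<le> count (x (g 1)) c"
    proof (cases "c \<in> C")
      case True
      then show ?thesis using g(2) incseqD[of "\<lambda>i. count (x (g i)) c" 0 1] by simp
    next
      case False
      then have "c \<notin># x (g 0)" using assms(2) by blast
      then show ?thesis by (simp add: not_in_iff)
    qed
  qed
  moreover have "g 0 < g 1" using g(1) by (simp add: strict_mono_def)
  ultimately show ?thesis by blast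
qed

text \<open>The analogue of the ascending chain condition for monomial ideals. A chain growing
  forever would supply elements that are each new at their stage; by Dickson's lemma one of them
  contains an earlier one and so, by upward closure, was not new.\<close>

lemma upward_closed_chain_stabilizes:
  fixes U :: "nat \<Rightarrow> 'c multiset set"
  assumes "finite C" and U: "incseq U" "\<And>i x. x \<in> U i \<Longrightarrow> set_mset x \<subseteq> C"
    and up: "\<And>i x y. x \<in> U i \<Longrightarrow> x \<subseteq># y \<Longrightarrow> set_mset y \<subseteq> C \<Longrightarrow> y \<in> U i"
  shows "\<exists>n. \<forall>m\<ge>n. U m = U n"
proof (rule ccontr)
  assume "\<not> ?thesis"
  then have "\<forall>n. \<exists>m x. n \<le> m \<and> x \<in> U m \<and> x \<notin> U n"
    using incseqD[OF U(1)] by (metis subsetI subset_antisym)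
  then obtain m x where mx: "\<And>n. n \<le> m n" "\<And>n. x n \<in> U (m n)" "\<And>n. x n \<notin> U n" by metis
  \<comment> \<open>Iterating \<open>m\<close> spaces the stages so that \<open>x (f k)\<close> lies
    outside \<open>U (f k)\<close> but inside \<open>U (f (Suc k))\<close>.\<close>
  define f where "f k = (m ^^ k) 0" for k
  have f_Suc: "f (Suc k) = m (f k)" for k by (simp add: f_def)
  have "incseq f" using mx(1) by (intro incseq_SucI) (simp add: f_Suc)
  obtain i j where ij: "i < j" "x (f i) \<subseteq># x (f j)"
    using dickson[OF assms(1), of "\<lambda>k. x (f k)"] U(2)[OF mx(2)] by blast
  have "f (Suc i) \<le> f j" using incseqD[OF \<open>incseq f\<close>] ij(1) by simp
  then have "U (f (Suc i)) \<subseteq> U (f j)" by (rule incseqD[OF U(1)])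
  then have "x (f i) \<in> U (f j)" using mx(2)[of "f i"] by (auto simp: f_Suc)
  then have "x (f j) \<in> U (f j)" using ij(2) U(2)[OF mx(2)] by (rule up)
  then show False using mx(3) by blast
qed

text \<open>Once the set of reducible monomials has stabilized, \<open>pending\<close> would have to
  decrease forever.\<close>

lemma (in admissible_order) update_terminates:
  assumes "finite C" and inv: "update_inv E (\<sigma> 0)" and fin: "finite_state (\<sigma> 0)"
    and step: "\<And>i::nat. update_step C gt (\<sigma> i) (\<sigma> (Suc i))"
  shows False
proof -
  have inv: "update_inv E (\<sigma> i) \<and> finite_state (\<sigma> i)" for i
  proof (induction i)
    case (Suc i)
    then show ?case using update_inv_step[OF step] update_step_decreases[OF step] by blast
  qed (use inv fin in simp)
  have dec: "reducibles (\<sigma> i) \<subset> reducibles (\<sigma> (Suc i)) \<or>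
      reducibles (\<sigma> i) = reducibles (\<sigma> (Suc i)) \<and> pending (\<sigma> (Suc i)) < pending (\<sigma> i)" for i
    using update_step_decreases[OF step] inv by blast
  have "\<exists>n. \<forall>m\<ge>n. reducibles (\<sigma> m) = reducibles (\<sigma> n)"
  proof (rule upward_closed_chain_stabilizes[OF assms(1)])
    show "incseq (\<lambda>i. reducibles (\<sigma> i))" using dec by (intro incseq_SucI) blast
    show "set_mset x \<subseteq> C" if "x \<in> reducibles (\<sigma> i)" for i x
      using that by (auto simp: reducibles_def reducible_iff monomials_def split: prod.splits)
    show "y \<in> reducibles (\<sigma> i)" if "x \<in> reducibles (\<sigma> i)" "x \<subseteq># y" "set_mset y \<subseteq> C" for i x y
      using that subset_mset.order_trans[OF _ that(2)]
      by (force simp: reducibles_def reducible_iff monomials_def split: prod.splits)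
  qed
  then obtain n where n: "\<And>m. m \<ge> n \<Longrightarrow> reducibles (\<sigma> m) = reducibles (\<sigma> n)" by blast
  have "pending (\<sigma> (Suc (n + k))) < pending (\<sigma> (n + k))" for k
    using dec[of "n + k"] n[of "n + k"] n[of "Suc (n + k)"] by auto
  then show False
    using wf_no_infinite_down_chainE[OF wf_less_than, of "\<lambda>k. pending (\<sigma> (n + k))"] by auto
qed

text \<open>Since the procedure is nondeterministic, absence of infinite runs is stated apart from
  existence of a returning one, and correctness speaks of all returned systems. Finiteness of
  \<open>R\<^sub>f\<close> is asked for in the first half, whose measure counts equations.\<close>

theorem theorem6p2:
  fixes C :: "'c set"
    and gt\<^sub>C :: "'c \<Rightarrow> 'c \<Rightarrow> bool"
    and gt\<^sub>f :: "'c multiset \<Rightarrow> 'c multiset \<Rightarrow> bool"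
    and R\<^sub>f :: "('c multiset \<times> 'c multiset) set"
    and R\<^sub>C :: "('c \<times> 'c) set"
  assumes "finite C"
    and "strict_total_order_on C gt\<^sub>C"
    and "admissible C gt\<^sub>f"
    and "\<forall>c\<in>C. \<forall>d\<in>C. gt\<^sub>C c d \<longrightarrow> gt\<^sub>f {#c#} {#d#}"
    and "\<forall>M\<in>monomials C. (\<nexists>c. M = {#c#}) \<longrightarrow> (\<forall>d\<in>C. gt\<^sub>f M {#d#})"
    and "oriented C gt\<^sub>f R\<^sub>f"
    and "canonical (rstep C R\<^sub>f)"
    and "\<forall>(c, d)\<in>R\<^sub>C. c \<in> C \<and> d \<in> C \<and> gt\<^sub>C c d"
    and "canonical (\<lambda>c d. (c, d) \<in> R\<^sub>C)"
  shows "(finite R\<^sub>f \<longrightarrow>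
            update_AC_terminates C gt\<^sub>f R\<^sub>f R\<^sub>C \<and> (\<exists>R' N. update_AC C gt\<^sub>f R\<^sub>f R\<^sub>C R' N)) \<and>
         (\<forall>R' N. update_AC C gt\<^sub>f R\<^sub>f R\<^sub>C R' N \<longrightarrow>
            canonical_for C gt\<^sub>f
              (ACCC C ({(l, r) | l r. (l, r) \<in> R\<^sub>f} \<union> {({#c#}, {#d#}) | c d. (c, d) \<in> R\<^sub>C})) R')"
proof -
  interpret admissible_order C gt\<^sub>f using assms(3) by unfold_locales
  define E where "E = R\<^sub>f \<union> const_rules R\<^sub>C"
  have E_eq: "{(l, r) | l r. (l, r) \<in> R\<^sub>f} \<union> {({#c#}, {#d#}) | c d. (c, d) \<in> R\<^sub>C} = E"
    by (simp add: E_def const_rules_def)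
  let ?init = "update_init C R\<^sub>f R\<^sub>C" and ?steps = "(update_step C gt\<^sub>f)\<^sup>*\<^sup>*"
  have oK: "oriented C gt\<^sub>f (const_rules R\<^sub>C)"
    using assms(4,8) by (auto simp: oriented_def const_rules_def monomials_def)
  have E_mon: "E \<subseteq> Mon \<times> Mon"
    unfolding E_def using orientedD[OF oK] orientedD[OF assms(6)] by auto
  have init: "update_inv E ?init"
    unfolding E_def using update_inv_init[OF assms(6) _ oK] assms(7,9) by (simp add: canonical_def)
  have inv: "update_inv E \<sigma>" if "?steps ?init \<sigma>" for \<sigma>
    using that by (induction rule: rtranclp_induct) (use init update_inv_step in blast)+
  have part2: "canonical_for C gt\<^sub>f (ACCC C E) R'" if "update_AC C gt\<^sub>f R\<^sub>f R\<^sub>C R' N" for R' N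
    using inv that canonical_for_final[OF _ E_mon] unfolding update_AC_def by blast
  have part1: "update_AC_terminates C gt\<^sub>f R\<^sub>f R\<^sub>C" "\<exists>R' N. update_AC C gt\<^sub>f R\<^sub>f R\<^sub>C R' N"
    if "finite R\<^sub>f"
  proof -
    have "R\<^sub>C \<subseteq> C \<times> C" using assms(8) by auto
    then have "finite R\<^sub>C" using assms(1) finite_subset by blast
    then have "finite ((\<lambda>(c, d). ({#c#}, {#d#})) ` R\<^sub>C)" by (rule finite_imageI)
    moreover have "const_rules R\<^sub>C = (\<lambda>(c, d). ({#c#}, {#d#})) ` R\<^sub>C"
      by (auto simp: const_rules_def)
    ultimately have "finite (const_rules R\<^sub>C)" by simp
    moreover have "finite {(l, r) \<in> R\<^sub>f. P l r}" for P
      using \<open>finite R\<^sub>f\<close> by (rule rev_finite_subset) auto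
    ultimately have fin: "finite_state ?init"
      using \<open>finite R\<^sub>f\<close> by (simp add: update_init_def finite_state_def Let_def)
    show terminates: "update_AC_terminates C gt\<^sub>f R\<^sub>f R\<^sub>C"
      unfolding update_AC_terminates_def using update_terminates[OF assms(1)] init fin by metis
    show "\<exists>R' N. update_AC C gt\<^sub>f R\<^sub>f R\<^sub>C R' N"
    proof (rule ccontr)
      assume no: "\<not> ?thesis"
      have next_state: "\<exists>\<tau>. update_step C gt\<^sub>f \<sigma> \<tau>" if "?steps ?init \<sigma>" for \<sigma>
      proof -
        obtain S T R N where \<sigma>: "\<sigma> = (S, T, R, N)" by (cases \<sigma>)
        then have "\<not> (S = {} \<and> T = {})" using no that unfolding update_AC_def by blast
        then show ?thesis using update_step_exists inv[OF that] unfolding \<sigma> by blast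
      qed
      \<comment> \<open>If no run returned, every reachable state would have a successor and
        dependent choice would give an infinite run; the clause for \<open>n = 0\<close> fixes its
        first state.\<close>
      have "\<exists>\<sigma>. \<forall>n. (?steps ?init (\<sigma> n) \<and> (n = 0 \<longrightarrow> \<sigma> n = ?init)) \<and>
          update_step C gt\<^sub>f (\<sigma> n) (\<sigma> (Suc n))"
      proof (rule dependent_nat_choice)
        fix \<sigma> and n :: nat assume "?steps ?init \<sigma> \<and> (n = 0 \<longrightarrow> \<sigma> = ?init)"
        then show "\<exists>\<tau>. (?steps ?init \<tau> \<and> (Suc n = 0 \<longrightarrow> \<tau> = ?init)) \<and> update_step C gt\<^sub>f \<sigma> \<tau>"
          using next_state[of \<sigma>] by (metis nat.distinct(1) rtranclp.rtrancl_into_rtrancl)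
      qed blast
      then show False using terminates unfolding update_AC_terminates_def by blast
    qed
  qed
  show ?thesis
    unfolding E_eq using part1 part2 by blast
qed

end
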